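(* Suppose $X_1,\dots,X_n$ are i.i.d. under a sublinear expectation $\mathbb{E}$ with $\mathbb{E}[X_1]=-\mathbb{E}[-X_1]=\mu$, and denote $$\overline{\sigma}^2:=\mathbb{E}[(X_1-\mu)^2],\qquad\underline{\sigma}^2:=-\mathbb{E}[-(X_1-\mu)^2].$$ Let $Z$ be a standard Gaussian random variable (on a classical probability space with expectation $E$). (1) For every convex $\varphi\in lip(\mathbb{R})$, $$\Big|\mathbb{E}\Big\{\varphi\Big[\frac{\sum_{i=1}^n(X_i-\mu)}{\overline{\sigma}\sqrt{n}}\Big]\Big\}-E[\varphi(Z)]\Big|\le\frac{\log n+1}{\sqrt{n}}\Big(2+\mathbb{E}\Big[\Big|\frac{X_1-\mu}{\overline{\sigma}}\Big|^3\Big]\Big)\|\varphi'\|.$$ (2) For every concave $\varphi\in lip(\mathbb{R})$, $$\Big|\mathbb{E}\Big\{\varphi\Big[\frac{\sum_{i=1}^n(X_i-\mu)}{\underline{\sigma}\sqrt{n}}\Big]\Big\}-E[\varphi(Z)]\Big|\le\frac{\log n+1}{\sqrt{n}}\Big(\frac{2\overline{\sigma}}{\underline{\sigma}}+\mathbb{E}\Big[\Big|\frac{X_1-\mu}{\underline{\sigma}}\Big|^3\Big]\Big)\|\varphi'\|.$$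
   Context: Let $\{P_\theta:\theta\in\Theta\}$ be a set of probability measures on a measurable space $(\Omega,\mathcal{F})$, and let $E_\theta$ be the expectation under $P_\theta$. For a random variable $X$ such that $E_\theta[X]$ exists for all $\theta\in\Theta$, the sublinear expectation is $\mathbb{E}[X]:=\sup_{\theta\in\Theta}E_\theta[X]$. Two random variables $X,Y$ are identically distributed if $\mathbb{E}[\varphi(X)]=\mathbb{E}[\varphi(Y)]$ for all bounded continuous $\varphi$. A random vector $Y\in\mathbb{R}^k$ is independent of a random vector $X\in\mathbb{R}^l$ if $\mathbb{E}[\varphi(X,Y)]=\mathbb{E}\big\{\{\mathbb{E}[\varphi(x,Y)]\}_{x=X}\big\}$ for all bounded continuous $\varphi:\mathbb{R}^{l+k}\to\mathbb{R}$ (this relation is not symmetric). $X_1,\dots,X_n$ are i.i.d. if each $X_{i+1}$ is identically distributed as $X_1$ and independent of $(X_1,\dots,X_i)$. $lip(\mathbb{R})$ is the class of Lipschitz functions on $\mathbb{R}$, and $\|\cdot\|$ is the supremum norm ($\|\varphi'\|$ is the Lipschitz constant of $\varphi$). $\overline{\sigma},\underline{\sigma}$ are the nonnegative square roots. *)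

theory Defs
  imports "HOL-Probability.Probability"
begin

(* The expectation in the extended sense: it exists as soon as the positive or the
   negative part has finite mean, and may then be infinite. *)

definition expectation_exists :: "'a measure \<Rightarrow> ('a \<Rightarrow> real) \<Rightarrow> bool" where
  "expectation_exists M X \<longleftrightarrow> X \<in> borel_measurable M \<and>
     ((\<integral>\<^sup>+ w. ennreal (X w) \<partial>M) < \<infinity> \<or> (\<integral>\<^sup>+ w. ennreal (- X w) \<partial>M) < \<infinity>)"

(* ennreal truncates negative reals to 0, so the two integrals are those of the positive
   and of the negative part. If the expectation does not exist, the value is \<infinity>. *)
definition ext_expectation :: "'a measure \<Rightarrow> ('a \<Rightarrow> real) \<Rightarrow> ereal" where
  "ext_expectation M X =
     enn2ereal (\<integral>\<^sup>+ w. ennreal (X w) \<partial>M) - enn2ereal (\<integral>\<^sup>+ w. ennreal (- X w) \<partial>M)"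

lemma ext_expectation_integrable:
  assumes "integrable M X"
  shows "ext_expectation M X = ereal (\<integral>w. X w \<partial>M)"
proof -
  have fin: "(\<integral>\<^sup>+ w. ennreal (X w) \<partial>M) \<noteq> \<top>" "(\<integral>\<^sup>+ w. ennreal (- X w) \<partial>M) \<noteq> \<top>"
    using assms by (auto simp: real_integrable_def)
  have "enn2ereal x = ereal (enn2real x)" if "x \<noteq> \<top>" for x
    using that by (cases x) (auto simp: enn2ereal_ennreal)
  with fin show ?thesis
    by (simp add: ext_expectation_def real_lebesgue_integral_def[OF assms])
qed

definition sublinear_expectation ::
    "('t \<Rightarrow> 'a measure) \<Rightarrow> 't set \<Rightarrow> ('a \<Rightarrow> real) \<Rightarrow> ereal" where
  "sublinear_expectation P \<Theta> X = (SUP \<theta>\<in>\<Theta>. ext_expectation (P \<theta>) X)"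

definition identically_distributed ::
    "(('a \<Rightarrow> real) \<Rightarrow> ereal) \<Rightarrow> ('a \<Rightarrow> real) \<Rightarrow> ('a \<Rightarrow> real) \<Rightarrow> bool" where
  "identically_distributed EE X Y \<longleftrightarrow>
     (\<forall>\<phi>::real \<Rightarrow> real. continuous_on UNIV \<phi> \<and> bounded (range \<phi>) \<longrightarrow>
        EE (\<lambda>w. \<phi> (X w)) = EE (\<lambda>w. \<phi> (Y w)))"

(* Vectors in R^n are elements of the topological space Euclidean_space n, i.e.
   functions nat \<Rightarrow> real vanishing at all indices \<ge> n. *)

definition vec_of :: "nat \<Rightarrow> (nat \<Rightarrow> real) \<Rightarrow> nat \<Rightarrow> real" where
  "vec_of l x = (\<lambda>j. if j < l then x j else 0)"

definition vec_append :: "nat \<Rightarrow> (nat \<Rightarrow> real) \<Rightarrow> (nat \<Rightarrow> real) \<Rightarrow> nat \<Rightarrow> real" where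
  "vec_append l x y = (\<lambda>j. if j < l then x j else y (j - l))"

definition bounded_continuous :: "nat \<Rightarrow> ((nat \<Rightarrow> real) \<Rightarrow> real) \<Rightarrow> bool" where
  "bounded_continuous n \<phi> \<longleftrightarrow> continuous_map (Euclidean_space n) euclideanreal \<phi> \<and>
     bounded (\<phi> ` topspace (Euclidean_space n))"

(* The R^k-valued Y is independent of the R^l-valued X (not symmetric in X and Y).
   The inner expectation, of a bounded function, is finite for the functionals EE of
   interest, so real_of_ereal only adjusts the type. *)
definition independent_of ::
    "(('a \<Rightarrow> real) \<Rightarrow> ereal) \<Rightarrow> nat \<Rightarrow> ('a \<Rightarrow> nat \<Rightarrow> real) \<Rightarrow> nat \<Rightarrow> ('a \<Rightarrow> nat \<Rightarrow> real) \<Rightarrow> bool" where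
  "independent_of EE k Y l X \<longleftrightarrow>
     (\<forall>\<phi>. bounded_continuous (l + k) \<phi> \<longrightarrow>
        EE (\<lambda>w. \<phi> (vec_append l (X w) (Y w))) =
        EE (\<lambda>w. real_of_ereal (EE (\<lambda>w'. \<phi> (vec_append l (X w) (Y w'))))))"

(* The sequence is X 1, ..., X n; other values of X are irrelevant. *)
definition iid :: "(('a \<Rightarrow> real) \<Rightarrow> ereal) \<Rightarrow> nat \<Rightarrow> (nat \<Rightarrow> 'a \<Rightarrow> real) \<Rightarrow> bool" where
  "iid EE n X \<longleftrightarrow>
     (\<forall>i\<in>{1..<n}.
        identically_distributed EE (X (Suc i)) (X 1) \<and>
        independent_of EE 1 (\<lambda>w. vec_of 1 (\<lambda>_. X (Suc i) w)) i (\<lambda>w. vec_of i (\<lambda>j. X (Suc j) w)))"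

definition lip :: "(real \<Rightarrow> real) set" where
  "lip = {\<phi>. \<exists>L. L-lipschitz_on UNIV \<phi>}"

(* For Lipschitz \<phi> this is the supremum norm of the (a.e. defined) derivative of \<phi>. *)
definition lip_const :: "(real \<Rightarrow> real) \<Rightarrow> real" where
  "lip_const \<phi> = Inf {L. L-lipschitz_on UNIV \<phi>}"

end

theory Submission
  imports Defs
begin

text \<open>
  Lindeberg's replacement argument along the heat flow. Let \<open>heat f s x\<close> be the mean of
  \<open>f\<close> under a Gaussian of mean \<open>x\<close> and standard deviation \<open>s\<close>. A normalised summand \<open>Y\<close> under
  the sublinear expectation is replaced by a Gaussian of variance \<open>1/n\<close>, one summand at a time.
  After \<open>k\<close> replacements the test function is \<open>v = heat f (sqrt (k/n))\<close>, which is still convex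
  (concave), so the sign of its quadratic Taylor coefficient \<open>b\<close> is known. As the mean of \<open>Y\<close> is
  certain, the quadratic Taylor polynomial of \<open>v\<close> then has exactly the same sublinear and Gaussian
  expectation, \<open>v x + b/n\<close>, and only the cubic remainders contribute. Smoothing bounds the third
  derivative of \<open>v\<close> by \<open>3 L n/k\<close>, which yields a harmonic sum and hence the logarithm; the
  unsmoothed step \<open>k = 0\<close> is estimated by the Lipschitz property alone. Independence is only assumed
  for bounded test functions; it extends to Lipschitz ones by clamping, using the second moments.
\<close>

section \<open>The Gaussian heat flow\<close>

text \<open>Independence is not symmetric: only the latest summand can be averaged with the earlier
  ones frozen. The replacement therefore runs backwards, and after \<open>k\<close> steps the test
  function is evaluated at the sum of the first \<open>n - k\<close> summands. An upper expectation
  is only subadditive, so a quadratic term has a computable value only when the sign of its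
  coefficient is known: \<open>b \<ge> 0\<close> sees the upper variance alone,
  \<open>b \<le> 0\<close> the lower one alone. This decides the normalisation in the two parts. The
  test function is merely Lipschitz, so derivatives are put on the Gaussian density, where they
  become Hermite polynomials. In units of \<open>L / sqrt n\<close>, step \<open>k = 0\<close> costs
  \<open>r + 1\<close> and step \<open>k \<ge> 1\<close> costs
  \<open>(\<beta> + 2) / (2 * k)\<close>, where \<open>r\<close> is the ratio of the upper to the
  normalising deviation and \<open>\<beta>\<close> bounds the normalised third moment. That the
  total stays below \<open>(ln n + 1) * (2 * r + \<beta>)\<close> rests on \<open>r \<ge> 1\<close>
  and on \<open>\<beta> \<ge> 1\<close>, the latter a moment inequality.\<close>

abbreviation std_gaussian :: "real measure" where
  "std_gaussian \<equiv> density lborel std_normal_density"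

text \<open>The noise is scaled inside the argument, instead of being drawn from a normal density of
  deviation \<open>s\<close>, so that \<open>s = 0\<close> gives back \<open>f\<close> without a
  limit.\<close>

definition heat :: "(real \<Rightarrow> real) \<Rightarrow> real \<Rightarrow> real \<Rightarrow> real" where
  "heat f s x = (\<integral>y. f (x + s * y) \<partial>std_gaussian)"

section \<open>Lipschitz functions and Gaussian moments\<close>

lemma lipschitz_real_iff:
  fixes f :: "real \<Rightarrow> real"
  shows "L-lipschitz_on UNIV f \<longleftrightarrow> 0 \<le> L \<and> (\<forall>x y. \<bar>f x - f y\<bar> \<le> L * \<bar>x - y\<bar>)"
  by (auto simp: lipschitz_on_def dist_real_def)

lemma lipschitz_realD:
  fixes f :: "real \<Rightarrow> real"
  assumes "L-lipschitz_on UNIV f"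
  shows "\<bar>f x - f y\<bar> \<le> L * \<bar>x - y\<bar>"
  using assms by (simp add: lipschitz_real_iff)

lemma lipschitz_measurable:
  fixes f :: "real \<Rightarrow> real"
  assumes "L-lipschitz_on UNIV f"
  shows "f \<in> borel_measurable borel"
  using lipschitz_on_continuous_on[OF assms] by (rule borel_measurable_continuous_onI)

lemma lipschitz_growth:
  fixes f :: "real \<Rightarrow> real"
  assumes "L-lipschitz_on UNIV f"
  shows "\<bar>f (x + y)\<bar> \<le> \<bar>f x\<bar> + L * \<bar>y\<bar>"
  using lipschitz_realD[OF assms, of "x + y" x] by simp

lemma prob_std_gaussian: "prob_space std_gaussian"
  by (rule prob_space_normal_density) simp

lemma integrable_std_gaussian_power:
  "integrable std_gaussian (\<lambda>y. y ^ k)" "integrable std_gaussian (\<lambda>y. \<bar>y\<bar> ^ k)"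
  using integrable_std_normal_moment[of k] integrable_std_normal_moment_abs[of k]
  by (simp_all add: integrable_density)

lemma integral_std_gaussian_even:
  "(\<integral>y. y ^ (2 * k) \<partial>std_gaussian) = fact (2 * k) / (2 ^ k * fact k)"
  using integral_std_normal_moment_even[of k] by (simp add: integral_density)

lemma integral_std_gaussian_moments:
  "(\<integral>y. y \<partial>std_gaussian) = 0"
  "(\<integral>y. y\<^sup>2 \<partial>std_gaussian) = 1"
  "(\<integral>y. y ^ 4 \<partial>std_gaussian) = 3"
  "(\<integral>y. y ^ 6 \<partial>std_gaussian) = 15"
  using integral_std_normal_moment_odd[of 0] integral_std_gaussian_even[of 1]
    integral_std_gaussian_even[of 2] integral_std_gaussian_even[of 3]
  by (simp_all add: integral_density fact_numeral)

text \<open>Linear growth of \<open>f\<close> leaves absolute Gaussian moments as the dominating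
  function.\<close>

lemma integrable_std_gaussian_lipschitz:
  fixes f :: "real \<Rightarrow> real"
  assumes f: "L-lipschitz_on UNIV f"
  shows "integrable std_gaussian (\<lambda>y. f (x + s * y) * y ^ k)"
proof (rule Bochner_Integration.integrable_bound)
  show "integrable std_gaussian (\<lambda>y. \<bar>f x\<bar> * \<bar>y\<bar> ^ k + L * \<bar>s\<bar> * \<bar>y\<bar> ^ Suc k)"
    by (intro Bochner_Integration.integrable_add integrable_mult_right integrable_std_gaussian_power)
  have [measurable]: "f \<in> borel_measurable borel"
    by (rule lipschitz_measurable[OF f])
  show "(\<lambda>y. f (x + s * y) * y ^ k) \<in> borel_measurable std_gaussian"
    by measurable
  have "norm (f (x + s * y) * y ^ k) \<le> norm (\<bar>f x\<bar> * \<bar>y\<bar> ^ k + L * \<bar>s\<bar> * \<bar>y\<bar> ^ Suc k)" for y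
  proof -
    have "norm (f (x + s * y) * y ^ k) \<le> (\<bar>f x\<bar> + L * \<bar>s * y\<bar>) * \<bar>y\<bar> ^ k"
      using mult_right_mono[OF lipschitz_growth[OF f, of x "s * y"], of "\<bar>y\<bar> ^ k"]
      by (simp add: abs_mult power_abs)
    also have "\<dots> = \<bar>f x\<bar> * \<bar>y\<bar> ^ k + L * \<bar>s\<bar> * \<bar>y\<bar> ^ Suc k"
      by (simp add: abs_mult algebra_simps)
    finally show ?thesis
      unfolding real_norm_def by (rule order_trans[OF _ abs_ge_self])
  qed
  then show "AE y in std_gaussian. norm (f (x + s * y) * y ^ k)
      \<le> norm (\<bar>f x\<bar> * \<bar>y\<bar> ^ k + L * \<bar>s\<bar> * \<bar>y\<bar> ^ Suc k)"
    by simp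
qed

lemma integrable_heat:
  fixes f :: "real \<Rightarrow> real"
  assumes "L-lipschitz_on UNIV f"
  shows "integrable std_gaussian (\<lambda>y. f (x + s * y))"
  using integrable_std_gaussian_lipschitz[OF assms, of x s 0] by simp

text \<open>Pointwise AM-GM dominates each integrand by even powers, whose moments are known
  exactly. The third integral is the one that controls the third derivative of the heat flow:
  \<open>y ^ 3 - 3 * y\<close> is the Hermite polynomial of degree 3.\<close>

lemma integral_abs_std_gaussian_le:
  "(\<integral>y. \<bar>y\<bar> \<partial>std_gaussian) \<le> 1"
  "(\<integral>y. \<bar>y\<bar> ^ 3 \<partial>std_gaussian) \<le> 2"
  "(\<integral>y. \<bar>y\<bar> * \<bar>y ^ 3 - 3 * y\<bar> \<partial>std_gaussian) \<le> 3"
proof -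
  note [intro!] = Bochner_Integration.integrable_add integrable_mult_right integrable_mult_left
     integrable_std_gaussian_power Bochner_Integration.integrable_diff
  interpret prob_space std_gaussian by (rule prob_std_gaussian)
  have "(\<integral>y. \<bar>y\<bar> \<partial>std_gaussian) \<le> (\<integral>y. 1 / 2 + 1 / 2 * y\<^sup>2 \<partial>std_gaussian)"
  proof (rule integral_mono)
    show "integrable std_gaussian abs"
      using integrable_std_gaussian_power(2)[of 1] by simp
    show "\<bar>y\<bar> \<le> 1 / 2 + 1 / 2 * y\<^sup>2" for y :: real
      using zero_le_power2[of "\<bar>y\<bar> - 1"] by (simp add: power2_diff)
  qed auto
  also have "\<dots> = 1"
    using prob_space by (subst Bochner_Integration.integral_add) (auto simp: integral_std_gaussian_moments)
  finally show "(\<integral>y. \<bar>y\<bar> \<partial>std_gaussian) \<le> 1" .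
  have "(\<integral>y. \<bar>y\<bar> ^ 3 \<partial>std_gaussian) \<le> (\<integral>y. 1 / 2 * y\<^sup>2 + 1 / 2 * y ^ 4 \<partial>std_gaussian)"
  proof (rule integral_mono)
    show "\<bar>y\<bar> ^ 3 \<le> 1 / 2 * y\<^sup>2 + 1 / 2 * y ^ 4" for y :: real
    proof -
      have "0 \<le> (\<bar>y\<bar> * (\<bar>y\<bar> - 1))\<^sup>2"
        by simp
      also have "\<dots> = y ^ 4 - 2 * \<bar>y\<bar> ^ 3 + y\<^sup>2"
      proof -
        have "y ^ 4 = \<bar>y\<bar> ^ 4" "y\<^sup>2 = \<bar>y\<bar>\<^sup>2" by simp_all
        then show ?thesis
          by (simp only:) (simp add: power2_eq_square power3_eq_cube power4_eq_xxxx algebra_simps)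
      qed
      finally show ?thesis by simp
    qed
  qed auto
  also have "\<dots> = 2"
    by (subst Bochner_Integration.integral_add) (auto simp: integral_std_gaussian_moments)
  finally show "(\<integral>y. \<bar>y\<bar> ^ 3 \<partial>std_gaussian) \<le> 2" .
  have "(\<integral>y. \<bar>y\<bar> * \<bar>y ^ 3 - 3 * y\<bar> \<partial>std_gaussian)
      \<le> (\<integral>y. 1 / 4 * y ^ 6 - 3 / 2 * y ^ 4 + 13 / 4 * y\<^sup>2 \<partial>std_gaussian)"
  proof (rule integral_mono)
    have "integrable std_gaussian (\<lambda>y. \<bar>y ^ 4 - 3 * y ^ 2\<bar>)"
      by (intro integrable_abs) auto
    then show "integrable std_gaussian (\<lambda>y. \<bar>y\<bar> * \<bar>y ^ 3 - 3 * y\<bar>)"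
      by (simp add: abs_mult[symmetric] algebra_simps power_numeral_reduce)
    show "\<bar>y\<bar> * \<bar>y ^ 3 - 3 * y\<bar> \<le> 1 / 4 * y ^ 6 - 3 / 2 * y ^ 4 + 13 / 4 * y\<^sup>2" for y :: real
    proof -
      \<comment> \<open>weighted AM-GM; the weight 2 makes the resulting bound \<open>5 / 2\<close>\<close>
      have "0 \<le> (2 * \<bar>y\<bar> - \<bar>y ^ 3 - 3 * y\<bar>)\<^sup>2"
        by simp
      also have "\<dots> = 4 * y\<^sup>2 - 4 * (\<bar>y\<bar> * \<bar>y ^ 3 - 3 * y\<bar>) + (y ^ 3 - 3 * y)\<^sup>2"
        by (simp add: power2_diff)
      also have "(y ^ 3 - 3 * y)\<^sup>2 = y ^ 6 - 6 * y ^ 4 + 9 * y\<^sup>2"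
        by algebra
      finally show ?thesis by simp
    qed
  qed auto
  also have "\<dots> = 5 / 2"
    by (simp add: integrable_std_gaussian_power integral_std_gaussian_moments)
  finally show "(\<integral>y. \<bar>y\<bar> * \<bar>y ^ 3 - 3 * y\<bar> \<partial>std_gaussian) \<le> 3" by simp
qed

section \<open>Preservation properties and the semigroup law\<close>

lemma heat_0: "heat f 0 = f"
  using prob_space.prob_space[OF prob_std_gaussian] by (simp add: heat_def fun_eq_iff)

lemma heat_lipschitz:
  assumes f: "L-lipschitz_on UNIV f"
  shows "L-lipschitz_on UNIV (heat f s)"
proof -
  interpret prob_space std_gaussian by (rule prob_std_gaussian)
  have "\<bar>heat f s x - heat f s y\<bar> \<le> L * \<bar>x - y\<bar>" for x y
  proof -
    have "\<bar>heat f s x - heat f s y\<bar> = \<bar>\<integral>z. f (x + s * z) - f (y + s * z) \<partial>std_gaussian\<bar>"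
      unfolding heat_def by (subst Bochner_Integration.integral_diff) (auto intro: integrable_heat[OF f])
    also have "\<dots> \<le> (\<integral>z. \<bar>f (x + s * z) - f (y + s * z)\<bar> \<partial>std_gaussian)"
      by (rule integral_abs_bound)
    also have "\<dots> \<le> (\<integral>z. L * \<bar>x - y\<bar> \<partial>std_gaussian)"
    proof (rule integral_mono)
      show "\<bar>f (x + s * z) - f (y + s * z)\<bar> \<le> L * \<bar>x - y\<bar>" for z
        using lipschitz_realD[OF f, of "x + s * z" "y + s * z"] by simp
    qed (auto intro!: integrable_heat[OF f])
    finally show ?thesis using prob_space by simp
  qed
  then show ?thesis
    using f by (simp add: lipschitz_real_iff)
qed

lemma heat_convex:
  assumes f: "L-lipschitz_on UNIV f" and c: "convex_on UNIV f"
  shows "convex_on UNIV (heat f s)"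
proof (rule convex_onI)
  fix t x y :: real assume t: "0 < t" "t < 1"
  have "heat f s ((1 - t) *\<^sub>R x + t *\<^sub>R y)
      \<le> (\<integral>z. (1 - t) * f (x + s * z) + t * f (y + s * z) \<partial>std_gaussian)"
    unfolding heat_def
  proof (rule integral_mono)
    fix z
    have "(1 - t) *\<^sub>R x + t *\<^sub>R y + s * z = (1 - t) *\<^sub>R (x + s * z) + t *\<^sub>R (y + s * z)"
      by (simp add: algebra_simps)
    then show "f ((1 - t) *\<^sub>R x + t *\<^sub>R y + s * z) \<le> (1 - t) * f (x + s * z) + t * f (y + s * z)"
      using convex_onD[OF c, of t "x + s * z" "y + s * z"] t by simp
  qed (auto intro!: integrable_heat[OF f])
  also have "\<dots> = (1 - t) * heat f s x + t * heat f s y"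
    unfolding heat_def by (subst Bochner_Integration.integral_add) (auto intro: integrable_heat[OF f])
  finally show "heat f s ((1 - t) *\<^sub>R x + t *\<^sub>R y) \<le> (1 - t) * heat f s x + t * heat f s y" .
qed simp

text \<open>Gives the scaled noise a density, so that the convolution of normal densities becomes
  applicable.\<close>

lemma distr_std_gaussian_scale:
  assumes "0 < s"
  shows "distr std_gaussian borel (\<lambda>y. s * y) = density lborel (normal_density 0 s)"
proof -
  interpret prob_space std_gaussian by (rule prob_std_gaussian)
  have "distributed std_gaussian lborel (\<lambda>y. y) std_normal_density"
    by (auto simp: distributed_def intro!: measure_eqI) (simp add: emeasure_distr)
  from normal_density_affine[OF this, of s 0] assms
  show ?thesis
    by (simp add: distributed_def distr_def)
qed

lemma heat_conv_normal:
  assumes "0 < s" and [measurable]: "f \<in> borel_measurable borel"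
  shows "heat f s x = (\<integral>y. f (x + y) \<partial>density lborel (normal_density 0 s))"
  unfolding distr_std_gaussian_scale[OF assms(1), symmetric] heat_def
  by (subst integral_distr) auto

text \<open>The semigroup law: variances of independent Gaussians add, which is the convolution of
  their densities. The case \<open>s = 0\<close> is split off because a normal density of deviation
  0 is not a probability density.\<close>

lemma heat_heat:
  assumes f: "L-lipschitz_on UNIV f" and "0 \<le> s" "0 < t"
  shows "heat (heat f s) t x = heat f (sqrt (s\<^sup>2 + t\<^sup>2)) x"
proof (cases "s = 0")
  case True
  then show ?thesis using assms by (simp add: heat_0)
next
  case False
  with assms have s: "0 < s" by simp
  define A where "A u = density lborel (normal_density 0 u)" for u
  have A: "prob_space (A u)" if "0 < u" for u
    unfolding A_def using that by (rule prob_space_normal_density)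
  have sets_A[measurable_cong, simp]: "sets (A u) = sets borel" for u
    by (simp add: A_def)
  have [measurable]: "f \<in> borel_measurable borel"
    by (rule lipschitz_measurable[OF f])
  have [measurable]: "heat f s \<in> borel_measurable borel"
    by (rule lipschitz_measurable[OF heat_lipschitz[OF f]])
  have st: "0 < sqrt (s\<^sup>2 + t\<^sup>2)" using assms by (simp add: add_nonneg_pos)
  interpret S: prob_space "A s" using A[OF s] .
  interpret T: prob_space "A t" using A[OF \<open>0 < t\<close>] .
  interpret ST: pair_prob_space "A s" "A t" ..
  interpret TS: pair_prob_space "A t" "A s" ..
  have fin: "finite_measure (A u)" if "0 < u" for u
    using A[OF that] by (simp add: prob_space_def)
  have conv: "A t \<star> A s = A (sqrt (s\<^sup>2 + t\<^sup>2))"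
  proof -
    have "A t \<star> A s = density lborel (\<lambda>x. \<integral>\<^sup>+y. ennreal (normal_density 0 t (x - y)) * ennreal (normal_density 0 s y) \<partial>lborel)"
      unfolding A_def
      by (rule convolution_density) (use fin[OF s] fin[OF \<open>0 < t\<close>] in \<open>auto simp: A_def\<close>)
    also have "(\<lambda>x. \<integral>\<^sup>+y. ennreal (normal_density 0 t (x - y)) * ennreal (normal_density 0 s y) \<partial>lborel)
        = normal_density 0 (sqrt (t\<^sup>2 + s\<^sup>2))"
      using conv_normal_density_zero_mean[OF \<open>0 < t\<close> s] by (simp add: ennreal_mult')
    finally show ?thesis by (simp add: A_def add.commute)
  qed
  have int_A: "integrable (A u) (\<lambda>y. f (x + y))" if "0 < u" for u
    using integrable_heat[OF f, of x u] that
    unfolding A_def distr_std_gaussian_scale[OF that, symmetric]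
    by (subst integrable_distr_eq) auto
  \<comment> \<open>Fubini needs integrability on the product; it is pulled back along addition from
    the single Gaussian \<open>A t \<star> A s\<close>.\<close>
  have int: "integrable (A t \<Otimes>\<^sub>M A s) (\<lambda>p. f (x + (fst p + snd p)))"
  proof -
    have "integrable (distr (A t \<Otimes>\<^sub>M A s) borel (\<lambda>(x, y). x + y)) (\<lambda>y. f (x + y))"
      using int_A[OF st] conv by (simp add: convolution_def)
    then show ?thesis
      by (subst (asm) integrable_distr_eq) (auto simp: case_prod_beta)
  qed
  have "heat (heat f s) t x = (\<integral>y. \<integral>z. f (x + y + z) \<partial>A s \<partial>A t)"
    using assms s by (simp add: heat_conv_normal A_def)
  also have "\<dots> = (\<integral>p. f (x + (fst p + snd p)) \<partial>(A t \<Otimes>\<^sub>M A s))"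
    using TS.integral_fst'[OF int] by (simp add: add.assoc)
  also have "\<dots> = (\<integral>u. f (x + u) \<partial>(A t \<star> A s))"
    unfolding convolution_def by (subst integral_distr) (auto simp: case_prod_beta)
  also have "\<dots> = heat f (sqrt (s\<^sup>2 + t\<^sup>2)) x"
    unfolding conv using st by (simp add: heat_conv_normal A_def)
  finally show ?thesis .
qed

section \<open>Third-order Taylor expansion of the heat flow\<close>

lemma integrable_std_gaussian_lipschitz_hermite:
  assumes "L-lipschitz_on UNIV f"
  shows "integrable std_gaussian (\<lambda>t. f (x + t) * (t ^ 3 - 3 * t))"
    "integrable std_gaussian (\<lambda>t. f (x + t) * (t\<^sup>2 - 1))"
    "integrable std_gaussian (\<lambda>t. f (x + t) * t)"
proof -
  note I = integrable_std_gaussian_lipschitz[OF assms, of x 1, simplified]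
  from Bochner_Integration.integrable_diff[OF I[of 3] integrable_mult_right[OF I[of 1], of 3]]
  show "integrable std_gaussian (\<lambda>t. f (x + t) * (t ^ 3 - 3 * t))"
    by (simp add: algebra_simps)
  from Bochner_Integration.integrable_diff[OF I[of 2] I[of 0]]
  show "integrable std_gaussian (\<lambda>t. f (x + t) * (t\<^sup>2 - 1))"
    by (simp add: algebra_simps)
  from I[of 1] show "integrable std_gaussian (\<lambda>t. f (x + t) * t)"
    by simp
qed

text \<open>The third derivative of the Gaussian density is the density times
  \<open>- (t ^ 3 - 3 * t)\<close>. This polynomial has mean zero, so \<open>f\<close> may be
  centred at \<open>f x\<close>, and only \<open>L * \<bar>t\<bar>\<close> is left to integrate; the
  first bound is therefore independent of the size of \<open>f\<close>. The second bound, with the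
  absolute value inside, cannot profit from the cancellation and serves integrability in Fubini's
  theorem.\<close>

lemma third_hermite_bound:
  assumes f: "L-lipschitz_on UNIV f"
  shows "\<bar>\<integral>t. f (x + t) * (t ^ 3 - 3 * t) \<partial>std_gaussian\<bar> \<le> 3 * L"
    and "(\<integral>t. \<bar>f (x + t) * (t ^ 3 - 3 * t)\<bar> \<partial>std_gaussian)
      \<le> \<bar>f x\<bar> * (\<integral>t. \<bar>t ^ 3 - 3 * t\<bar> \<partial>std_gaussian) + 3 * L"
proof -
  note I = integrable_std_gaussian_lipschitz_hermite(1)[OF f]
  have L: "0 \<le> L" using f by (simp add: lipschitz_real_iff)
  have He: "integrable std_gaussian (\<lambda>t. t ^ 3 - 3 * t)"
  proof -
    have "0-lipschitz_on UNIV (\<lambda>_::real. 1::real)" by (rule lipschitz_on_constant)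
    from integrable_std_gaussian_lipschitz_hermite(1)[OF this] show ?thesis by simp
  qed
  have "integrable std_gaussian (\<lambda>t. \<bar>t ^ 4 - 3 * t ^ 2\<bar>)"
    by (intro integrable_abs Bochner_Integration.integrable_diff integrable_mult_right
        integrable_std_gaussian_power)
  then have He': "integrable std_gaussian (\<lambda>t. \<bar>t\<bar> * \<bar>t ^ 3 - 3 * t\<bar>)"
    by (simp add: abs_mult[symmetric] algebra_simps power_numeral_reduce)
  have He0: "(\<integral>t. t ^ 3 - 3 * t \<partial>std_gaussian) = 0"
  proof -
    have "(\<integral>t. t ^ 3 \<partial>std_gaussian) = 0"
      using integral_std_normal_moment_odd[of 1] by (simp add: integral_density)
    moreover have "integrable std_gaussian (\<lambda>t. t ^ 3)" "integrable std_gaussian (\<lambda>t. 3 * t)"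
      using integrable_std_gaussian_power(1)[of 3] integrable_std_gaussian_power(1)[of 1] by simp_all
    ultimately show ?thesis
      by (simp add: integral_std_gaussian_moments)
  qed
  have "(\<integral>t. f (x + t) * (t ^ 3 - 3 * t) \<partial>std_gaussian)
      = (\<integral>t. f (x + t) * (t ^ 3 - 3 * t) - f x * (t ^ 3 - 3 * t) \<partial>std_gaussian)"
    using I He by (simp add: He0)
  then have "\<bar>\<integral>t. f (x + t) * (t ^ 3 - 3 * t) \<partial>std_gaussian\<bar>
      \<le> (\<integral>t. \<bar>f (x + t) * (t ^ 3 - 3 * t) - f x * (t ^ 3 - 3 * t)\<bar> \<partial>std_gaussian)"
    by (simp only: integral_abs_bound)
  also have "\<dots> \<le> (\<integral>t. L * (\<bar>t\<bar> * \<bar>t ^ 3 - 3 * t\<bar>) \<partial>std_gaussian)"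
  proof (rule integral_mono)
    fix t
    have "\<bar>f (x + t) * (t ^ 3 - 3 * t) - f x * (t ^ 3 - 3 * t)\<bar> = \<bar>f (x + t) - f x\<bar> * \<bar>t ^ 3 - 3 * t\<bar>"
      by (simp only: abs_mult left_diff_distrib[symmetric])
    also have "\<dots> \<le> L * \<bar>t\<bar> * \<bar>t ^ 3 - 3 * t\<bar>"
      using lipschitz_realD[OF f, of "x + t" x] by (intro mult_right_mono) auto
    finally show "\<bar>f (x + t) * (t ^ 3 - 3 * t) - f x * (t ^ 3 - 3 * t)\<bar> \<le> L * (\<bar>t\<bar> * \<bar>t ^ 3 - 3 * t\<bar>)"
      by (simp only: mult.assoc)
  next
    show "integrable std_gaussian (\<lambda>t. \<bar>f (x + t) * (t ^ 3 - 3 * t) - f x * (t ^ 3 - 3 * t)\<bar>)"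
      by (rule integrable_abs[OF Bochner_Integration.integrable_diff[OF I integrable_mult_right[OF He]]])
  qed (rule integrable_mult_right[OF He'])
  also have "\<dots> \<le> L * 3"
    using mult_left_mono[OF integral_abs_std_gaussian_le(3) L] by simp
  finally show "\<bar>\<integral>t. f (x + t) * (t ^ 3 - 3 * t) \<partial>std_gaussian\<bar> \<le> 3 * L" by simp
  have "(\<integral>t. \<bar>f (x + t) * (t ^ 3 - 3 * t)\<bar> \<partial>std_gaussian)
      \<le> (\<integral>t. \<bar>f x\<bar> * \<bar>t ^ 3 - 3 * t\<bar> + L * (\<bar>t\<bar> * \<bar>t ^ 3 - 3 * t\<bar>) \<partial>std_gaussian)"
  proof (rule integral_mono)
    fix t
    have "\<bar>f (x + t)\<bar> * \<bar>t ^ 3 - 3 * t\<bar> \<le> (\<bar>f x\<bar> + L * \<bar>t\<bar>) * \<bar>t ^ 3 - 3 * t\<bar>"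
      by (intro mult_right_mono lipschitz_growth[OF f]) auto
    then show "\<bar>f (x + t) * (t ^ 3 - 3 * t)\<bar> \<le> \<bar>f x\<bar> * \<bar>t ^ 3 - 3 * t\<bar> + L * (\<bar>t\<bar> * \<bar>t ^ 3 - 3 * t\<bar>)"
      by (simp add: abs_mult distrib_right mult.assoc)
  next
    show "integrable std_gaussian (\<lambda>t. \<bar>f x\<bar> * \<bar>t ^ 3 - 3 * t\<bar> + L * (\<bar>t\<bar> * \<bar>t ^ 3 - 3 * t\<bar>))"
      by (rule Bochner_Integration.integrable_add[OF integrable_mult_right[OF integrable_abs[OF He]]
            integrable_mult_right[OF He']])
  qed (rule integrable_abs[OF I])
  also have "\<dots> = \<bar>f x\<bar> * (\<integral>t. \<bar>t ^ 3 - 3 * t\<bar> \<partial>std_gaussian)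
      + L * (\<integral>t. \<bar>t\<bar> * \<bar>t ^ 3 - 3 * t\<bar> \<partial>std_gaussian)"
    using integrable_abs[OF He] He' by simp
  also have "L * (\<integral>t. \<bar>t\<bar> * \<bar>t ^ 3 - 3 * t\<bar> \<partial>std_gaussian) \<le> L * 3"
    by (intro mult_left_mono integral_abs_std_gaussian_le(3) L)
  finally show "(\<integral>t. \<bar>f (x + t) * (t ^ 3 - 3 * t)\<bar> \<partial>std_gaussian)
      \<le> \<bar>f x\<bar> * (\<integral>t. \<bar>t ^ 3 - 3 * t\<bar> \<partial>std_gaussian) + 3 * L" by simp
qed

lemma DERIV_std_normal_density:
  "(std_normal_density has_real_derivative (- x * std_normal_density x)) (at x)"
proof -
  have "((\<lambda>x. exp (- x\<^sup>2 / 2)) has_real_derivative (- x * exp (- x\<^sup>2 / 2))) (at x)"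
    by (auto intro!: derivative_eq_intros)
  from DERIV_cmult[OF this, of "1 / sqrt (2 * pi)"] show ?thesis
    by (simp add: std_normal_density_def[abs_def] ac_simps)
qed

text \<open>The remainder integral is scaled to \<open>{0..1}\<close> so that both signs of \<open>h\<close> are covered.\<close>

lemma std_normal_density_taylor:
  "(\<integral>r. (1 - r)\<^sup>2 / 2 * h ^ 3 * ((y - h * r) ^ 3 - 3 * (y - h * r)) * std_normal_density (y - h * r)
      * indicator {0..1} r \<partial>lborel)
    = std_normal_density (y - h) - std_normal_density y - h * (y * std_normal_density y)
      - h\<^sup>2 / 2 * ((y\<^sup>2 - 1) * std_normal_density y)" (is "(\<integral>r. ?k r * _ \<partial>_) = ?R")
proof -
  let ?g = "std_normal_density"
  \<comment> \<open>\<open>?F r\<close> is the Taylor polynomial of degree 2 centred at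
    \<open>y - h * r\<close> and evaluated at \<open>y - h\<close>. In its derivative in
    \<open>r\<close> all terms but the one of third order cancel.\<close>
  let ?F = "\<lambda>r. ?g (y - h * r) + (1 - r) * h * (y - h * r) * ?g (y - h * r)
      + (1 - r)\<^sup>2 / 2 * h\<^sup>2 * ((y - h * r)\<^sup>2 - 1) * ?g (y - h * r)"
  have g: "((\<lambda>r. ?g (y - h * r)) has_real_derivative h * (y - h * r) * ?g (y - h * r)) (at r)" for r
    by (rule DERIV_chain2[OF DERIV_std_normal_density, THEN DERIV_cong])
      (auto intro!: derivative_eq_intros simp: algebra_simps)
  have "(\<integral>r. ?k r * indicator {0..1} r \<partial>lborel) = ?F 1 - ?F 0"
  proof (rule integral_FTC_Icc_real)
    show "(?F has_real_derivative ?k r) (at r)" for r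
      by (rule derivative_eq_intros g refl | simp)+
        (simp add: power2_eq_square power3_eq_cube field_simps)
    have "isCont (\<lambda>r. ?g (y - h * r)) r" for r
      using g DERIV_isCont by blast
    then show "isCont ?k r" for r
      by (intro continuous_intros) auto
  qed simp
  then show ?thesis by simp
qed

text \<open>The shift by \<open>h\<close> is moved from \<open>f\<close> to the density, which is
  then expanded to second order in \<open>h\<close>. In the remainder Fubini brings the Taylor
  parameter \<open>r\<close> outside; for fixed \<open>r\<close> the inner integral is a Hermite
  integral centred at \<open>x + h * r\<close>, at most \<open>3 * L\<close>. The weight
  \<open>(1 - r)\<^sup>2 / 2\<close> has integral \<open>1 / 6\<close>, whence the constant
  \<open>1 / 2\<close>.\<close>

lemma heat_1_taylor:
  assumes f: "L-lipschitz_on UNIV f"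
  shows "\<exists>a b. \<forall>h. \<bar>heat f 1 (x + h) - heat f 1 x - a * h - b * h\<^sup>2\<bar> \<le> L * \<bar>h\<bar> ^ 3 / 2"
proof -
  let ?g = "std_normal_density"
  have L: "0 \<le> L" using f by (simp add: lipschitz_real_iff)
  have [measurable]: "f \<in> borel_measurable borel"
    by (rule lipschitz_measurable[OF f])
  \<comment> \<open>\<open>a\<close> and \<open>2 * b\<close> are the first and second derivative of
    the heat flow at \<open>x\<close>, written with the Hermite polynomials of degree 1 and
    2.\<close>
  define a where "a = (\<integral>y. f (x + y) * y \<partial>std_gaussian)"
  define b where "b = (\<integral>y. f (x + y) * (y\<^sup>2 - 1) \<partial>std_gaussian) / 2"
  define k where "k h r y = (1 - r)\<^sup>2 / 2 * h ^ 3 * ((y - h * r) ^ 3 - 3 * (y - h * r)) * ?g (y - h * r)"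
    for h r y :: real
  have [measurable]: "(\<lambda>p. k h (fst p) (snd p)) \<in> borel_measurable (lborel \<Otimes>\<^sub>M lborel)" for h
    unfolding k_def by measurable
  \<comment> \<open>The substitution \<open>y = h * r + t\<close> recentres the Gaussian, so that
    \<open>third_hermite_bound\<close> applies at the point \<open>x + h * r\<close>.\<close>
  have inner: "(\<integral>y. f (x + y) * (k h r y * indicator {0..1} r) \<partial>lborel)
      = (1 - r)\<^sup>2 / 2 * indicator {0..1} r * h ^ 3
        * (\<integral>t. f (x + h * r + t) * (t ^ 3 - 3 * t) \<partial>std_gaussian)"
    and inner_abs: "(\<integral>y. \<bar>f (x + y) * (k h r y * indicator {0..1} r)\<bar> \<partial>lborel)
      = (1 - r)\<^sup>2 / 2 * indicator {0..1} r * \<bar>h\<bar> ^ 3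
        * (\<integral>t. \<bar>f (x + h * r + t) * (t ^ 3 - 3 * t)\<bar> \<partial>std_gaussian)"
    and inner_int: "integrable lborel (\<lambda>y. f (x + y) * (k h r y * indicator {0..1} r))" for h r
  proof -
    define c where "c = (1 - r)\<^sup>2 / 2 * indicator {0..1} r * h ^ 3"
    have eq: "f (x + (h * r + t)) * (k h r (h * r + t) * indicator {0..1} r)
        = c * (?g t * (f (x + h * r + t) * (t ^ 3 - 3 * t)))" for t
      by (simp add: k_def c_def add.assoc mult_ac)
    have aff: "(\<integral>y. F y \<partial>lborel) = (\<integral>t. F (h * r + t) \<partial>lborel)" for F :: "real \<Rightarrow> real"
      using lborel_integral_real_affine[of 1 F "h * r"] by simp
    have "integrable lborel (\<lambda>t. ?g t * (f (x + h * r + t) * (t ^ 3 - 3 * t)))"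
      using integrable_std_gaussian_lipschitz_hermite(1)[OF f, of "x + h * r"]
      by (simp add: integrable_density)
    then have "integrable lborel (\<lambda>t. f (x + (h * r + t)) * (k h r (h * r + t) * indicator {0..1} r))"
      unfolding eq by (rule integrable_mult_right)
    then show "integrable lborel (\<lambda>y. f (x + y) * (k h r y * indicator {0..1} r))"
      using lborel_integrable_real_affine_iff[of 1 "\<lambda>y. f (x + y) * (k h r y * indicator {0..1} r)" "h * r"]
      by simp
    show "(\<integral>y. f (x + y) * (k h r y * indicator {0..1} r) \<partial>lborel)
      = (1 - r)\<^sup>2 / 2 * indicator {0..1} r * h ^ 3
        * (\<integral>t. f (x + h * r + t) * (t ^ 3 - 3 * t) \<partial>std_gaussian)"
      by (subst aff) (simp only: eq integral_mult_right_zero c_def[symmetric], simp add: integral_density)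
    have "\<bar>c\<bar> = (1 - r)\<^sup>2 / 2 * indicator {0..1} r * \<bar>h\<bar> ^ 3"
      by (simp add: c_def abs_mult power_abs)
    then show "(\<integral>y. \<bar>f (x + y) * (k h r y * indicator {0..1} r)\<bar> \<partial>lborel)
      = (1 - r)\<^sup>2 / 2 * indicator {0..1} r * \<bar>h\<bar> ^ 3
        * (\<integral>t. \<bar>f (x + h * r + t) * (t ^ 3 - 3 * t)\<bar> \<partial>std_gaussian)"
      by (subst aff) (simp only: eq abs_mult integral_mult_right_zero, simp add: integral_density)
  qed
  have "\<bar>heat f 1 (x + h) - heat f 1 x - a * h - b * h\<^sup>2\<bar> \<le> L * \<bar>h\<bar> ^ 3 / 2" for h
  proof -
    let ?G = "\<lambda>r y. f (x + y) * (k h r y * indicator {0..1} r)"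
    have int: "integrable (lborel \<Otimes>\<^sub>M lborel) (case_prod ?G)"
    proof (rule lborel_pair.Fubini_integrable)
      \<comment> \<open>A bound on the inner absolute integral that is uniform over \<open>r\<close>
        in the unit interval. It depends on \<open>f x\<close>, which is harmless since only
        integrability is at stake.\<close>
      define C where "C = \<bar>h\<bar> ^ 3 * ((\<bar>f x\<bar> + L * \<bar>h\<bar>) * (\<integral>t. \<bar>t ^ 3 - 3 * t\<bar> \<partial>std_gaussian) + 3 * L)"
      show "case_prod ?G \<in> borel_measurable (lborel \<Otimes>\<^sub>M lborel)"
        unfolding case_prod_beta by measurable
      show "integrable lborel (\<lambda>r. \<integral>y. norm (case (r, y) of (r, y) \<Rightarrow> ?G r y) \<partial>lborel)"
      proof (rule Bochner_Integration.integrable_bound)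
        show "integrable lborel (\<lambda>r::real. C * indicator {0..1} r)"
          by (intro integrable_mult_right integrable_real_indicator) auto
        show "(\<lambda>r. \<integral>y. norm (case (r, y) of (r, y) \<Rightarrow> ?G r y) \<partial>lborel) \<in> borel_measurable lborel"
          unfolding case_prod_beta by measurable
        have "(1 - r)\<^sup>2 / 2 * \<bar>h\<bar> ^ 3 * (\<integral>t. \<bar>f (x + h * r + t) * (t ^ 3 - 3 * t)\<bar> \<partial>std_gaussian) \<le> C"
          if r: "0 \<le> r" "r \<le> 1" for r
        proof -
          have "\<bar>f (x + h * r)\<bar> \<le> \<bar>f x\<bar> + L * \<bar>h * r\<bar>"
            by (rule lipschitz_growth[OF f])
          also have "L * \<bar>h * r\<bar> \<le> L * \<bar>h\<bar>"
            using r L by (intro mult_left_mono) (auto simp: abs_mult mult_left_le)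
          finally have "\<bar>f (x + h * r)\<bar> * (\<integral>t. \<bar>t ^ 3 - 3 * t\<bar> \<partial>std_gaussian)
              \<le> (\<bar>f x\<bar> + L * \<bar>h\<bar>) * (\<integral>t. \<bar>t ^ 3 - 3 * t\<bar> \<partial>std_gaussian)"
            by (intro mult_right_mono) auto
          with third_hermite_bound(2)[OF f, of "x + h * r"]
          have "\<bar>h\<bar> ^ 3 * (\<integral>t. \<bar>f (x + h * r + t) * (t ^ 3 - 3 * t)\<bar> \<partial>std_gaussian) \<le> C"
            unfolding C_def by (intro mult_left_mono) auto
          moreover have "(1 - r)\<^sup>2 / 2 \<le> 1"
            using r power_le_one[of "1 - r" 2] by simp
          ultimately have "(1 - r)\<^sup>2 / 2 * (\<bar>h\<bar> ^ 3 * (\<integral>t. \<bar>f (x + h * r + t) * (t ^ 3 - 3 * t)\<bar> \<partial>std_gaussian)) \<le> 1 * C"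
            by (intro mult_mono) (auto intro!: mult_nonneg_nonneg Bochner_Integration.integral_nonneg)
          then show ?thesis by (simp add: mult.assoc)
        qed
        moreover have "0 \<le> C"
          unfolding C_def using L
          by (intro mult_nonneg_nonneg add_nonneg_nonneg Bochner_Integration.integral_nonneg) auto
        ultimately have "norm (\<integral>y. norm (case (r, y) of (r, y) \<Rightarrow> ?G r y) \<partial>lborel)
            \<le> norm (C * indicator {0..1} r)" for r
          unfolding prod.case real_norm_def inner_abs
          by (cases "r \<in> {0..1}") (auto simp: abs_mult)
        then show "AE r in lborel. norm (\<integral>y. norm (case (r, y) of (r, y) \<Rightarrow> ?G r y) \<partial>lborel)
            \<le> norm (C * indicator {0..1} r)"
          by (rule AE_I2)
      qed
      show "AE r in lborel. integrable lborel (\<lambda>y. case (r, y) of (r, y) \<Rightarrow> ?G r y)"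
        unfolding prod.case by (rule AE_I2) (rule inner_int)
    qed
    have "heat f 1 (x + h) = (\<integral>y. f (x + y) * ?g (y - h) \<partial>lborel)"
      and "integrable lborel (\<lambda>y. f (x + y) * ?g (y - h))"
    proof -
      have "heat f 1 (x + h) = (\<integral>t. ?g t * f (x + h + t) \<partial>lborel)"
        by (simp add: heat_def integral_density)
      also have "\<dots> = (\<integral>y. f (x + y) * ?g (y - h) \<partial>lborel)"
        using lborel_integral_real_affine[of 1 "\<lambda>y. f (x + y) * ?g (y - h)" h]
        by (simp add: ac_simps)
      finally show "heat f 1 (x + h) = (\<integral>y. f (x + y) * ?g (y - h) \<partial>lborel)" .
      have "integrable lborel (\<lambda>t. ?g t * f (x + h + t))"
        using integrable_heat[OF f, of "x + h" 1] by (simp add: integrable_density)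
      then show "integrable lborel (\<lambda>y. f (x + y) * ?g (y - h))"
        using lborel_integrable_real_affine_iff[of 1 "\<lambda>y. f (x + y) * ?g (y - h)" h]
        by (simp add: ac_simps)
    qed
    moreover have "heat f 1 x = (\<integral>y. f (x + y) * ?g y \<partial>lborel)"
      by (simp add: heat_def integral_density mult.commute)
    moreover have "a * h = (\<integral>y. f (x + y) * (h * (y * ?g y)) \<partial>lborel)"
    proof -
      have "a * h = (\<integral>y. h * (f (x + y) * y) \<partial>std_gaussian)"
        by (simp add: a_def)
      also have "\<dots> = (\<integral>y. ?g y *\<^sub>R (h * (f (x + y) * y)) \<partial>lborel)"
        by (rule integral_density) auto
      also have "\<dots> = (\<integral>y. f (x + y) * (h * (y * ?g y)) \<partial>lborel)"
        by (intro Bochner_Integration.integral_cong refl) (simp add: mult_ac)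
      finally show ?thesis .
    qed
    moreover have "b * h\<^sup>2 = (\<integral>y. f (x + y) * (h\<^sup>2 / 2 * ((y\<^sup>2 - 1) * ?g y)) \<partial>lborel)"
    proof -
      have "b * h\<^sup>2 = (\<integral>y. h\<^sup>2 / 2 * (f (x + y) * (y\<^sup>2 - 1)) \<partial>std_gaussian)"
        unfolding integral_mult_right_zero by (simp add: b_def)
      also have "\<dots> = (\<integral>y. ?g y *\<^sub>R (h\<^sup>2 / 2 * (f (x + y) * (y\<^sup>2 - 1))) \<partial>lborel)"
        by (rule integral_density) auto
      also have "\<dots> = (\<integral>y. f (x + y) * (h\<^sup>2 / 2 * ((y\<^sup>2 - 1) * ?g y)) \<partial>lborel)"
        by (intro Bochner_Integration.integral_cong refl) (simp add: mult_ac)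
      finally show ?thesis .
    qed
    moreover have "integrable lborel (\<lambda>y. f (x + y) * ?g y)"
      "integrable lborel (\<lambda>y. f (x + y) * (h * (y * ?g y)))"
      "integrable lborel (\<lambda>y. f (x + y) * (h\<^sup>2 / 2 * ((y\<^sup>2 - 1) * ?g y)))"
      using integrable_heat[OF f, of x 1]
        integrable_mult_right[OF integrable_std_gaussian_lipschitz_hermite(3)[OF f, of x], of h]
        integrable_mult_right[OF integrable_std_gaussian_lipschitz_hermite(2)[OF f, of x], of "h\<^sup>2 / 2"]
      by (simp_all add: integrable_density ac_simps)
    ultimately have "heat f 1 (x + h) - heat f 1 x - a * h - b * h\<^sup>2
        = (\<integral>y. f (x + y) * ?g (y - h) - f (x + y) * ?g y - f (x + y) * (h * (y * ?g y))
            - f (x + y) * (h\<^sup>2 / 2 * ((y\<^sup>2 - 1) * ?g y)) \<partial>lborel)"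
      by simp
    also have "\<dots> = (\<integral>y. (\<integral>r. ?G r y \<partial>lborel) \<partial>lborel)"
      using std_normal_density_taylor[of h]
      by (simp add: k_def right_diff_distrib)
    also have "\<dots> = (\<integral>r. (\<integral>y. ?G r y \<partial>lborel) \<partial>lborel)"
      by (rule lborel_pair.Fubini_integral[OF int])
    also have "\<bar>\<dots>\<bar> \<le> (\<integral>r. \<bar>\<integral>y. ?G r y \<partial>lborel\<bar> \<partial>lborel)"
      by (rule integral_abs_bound)
    also have "\<dots> \<le> (\<integral>r. \<bar>h\<bar> ^ 3 * (3 * L) * ((1 - r)\<^sup>2 / 2 * indicator {0..1} r) \<partial>lborel)"
    proof (rule integral_mono)
      show "integrable lborel (\<lambda>r. \<bar>\<integral>y. ?G r y \<partial>lborel\<bar>)"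
        using lborel_pair.integrable_fst'[OF int] by simp
      have "set_integrable lborel {0..1} (\<lambda>r::real. (1 - r)\<^sup>2 / 2)"
        by (intro borel_integrable_atLeastAtMost' continuous_intros) auto
      then show "integrable lborel (\<lambda>r. \<bar>h\<bar> ^ 3 * (3 * L) * ((1 - r)\<^sup>2 / 2 * indicator {0..1} r))"
        by (intro integrable_mult_right) (simp add: set_integrable_def mult.commute)
      fix r :: real
      have "(1 - r)\<^sup>2 / 2 * indicator {0..1} r * \<bar>h\<bar> ^ 3 * \<bar>\<integral>t. f (x + h * r + t) * (t ^ 3 - 3 * t) \<partial>std_gaussian\<bar>
          \<le> (1 - r)\<^sup>2 / 2 * indicator {0..1} r * \<bar>h\<bar> ^ 3 * (3 * L)"
        by (intro mult_left_mono third_hermite_bound(1)[OF f]) auto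
      then show "\<bar>\<integral>y. ?G r y \<partial>lborel\<bar> \<le> \<bar>h\<bar> ^ 3 * (3 * L) * ((1 - r)\<^sup>2 / 2 * indicator {0..1} r)"
        unfolding inner by (simp add: abs_mult power_abs ac_simps)
    qed
    also have "\<dots> = \<bar>h\<bar> ^ 3 * (3 * L) * (1 / 6)"
    proof -
      have "(\<integral>r. (1 - r)\<^sup>2 / 2 * indicator {0..1} r \<partial>lborel)
          = (- ((1 - 1) ^ 3 / 6)) - (- ((1 - 0) ^ 3 / 6 :: real))"
        by (rule integral_FTC_Icc_real) (auto intro!: derivative_eq_intros continuous_intros)
      then show ?thesis by simp
    qed
    finally show ?thesis by simp
  qed
  then show ?thesis by blast
qed

text \<open>Scaling reduces to \<open>s = 1\<close>: the Lipschitz constant gains a factor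
  \<open>s\<close> and the cubic displacement loses \<open>s ^ 3\<close>. The resulting
  \<open>1 / s\<^sup>2\<close> is the reciprocal of the variance already inserted, which is the
  source of the harmonic sum.\<close>

lemma heat_taylor:
  assumes f: "L-lipschitz_on UNIV f" and s: "0 < s"
  obtains a b where
    "\<And>h. \<bar>heat f s (x + h) - heat f s x - a * h - b * h\<^sup>2\<bar> \<le> L * \<bar>h\<bar> ^ 3 / (2 * s\<^sup>2)"
proof -
  define f' where "f' y = f (s * y)" for y
  have "(s * L)-lipschitz_on UNIV f'"
    unfolding lipschitz_real_iff f'_def
  proof (intro conjI allI)
    show "0 \<le> s * L" using f s by (simp add: lipschitz_real_iff)
    fix y z
    have "\<bar>f (s * y) - f (s * z)\<bar> \<le> L * \<bar>s * y - s * z\<bar>"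
      by (rule lipschitz_realD[OF f])
    also have "\<bar>s * y - s * z\<bar> = s * \<bar>y - z\<bar>"
      using s by (simp add: abs_mult flip: right_diff_distrib)
    finally show "\<bar>f (s * y) - f (s * z)\<bar> \<le> s * L * \<bar>y - z\<bar>" by (simp add: ac_simps)
  qed
  from heat_1_taylor[OF this, of "x / s"] obtain a b where ab:
    "\<And>h. \<bar>heat f' 1 (x / s + h) - heat f' 1 (x / s) - a * h - b * h\<^sup>2\<bar> \<le> s * L * \<bar>h\<bar> ^ 3 / 2"
    by blast
  have scale: "heat f' 1 (y / s) = heat f s y" for y
    using s by (simp add: heat_def f'_def distrib_left)
  show ?thesis
  proof (rule that[of "a / s" "b / s\<^sup>2"])
    fix h
    have "\<bar>heat f s (x + h) - heat f s x - a * (h / s) - b * (h / s)\<^sup>2\<bar> \<le> s * L * \<bar>h / s\<bar> ^ 3 / 2"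
      using ab[of "h / s"] scale[of "x + h"] scale[of x] by (simp add: add_divide_distrib)
    also have "s * L * \<bar>h / s\<bar> ^ 3 / 2 = L * \<bar>h\<bar> ^ 3 / (2 * s\<^sup>2)"
      using s by (simp add: abs_divide power2_eq_square power3_eq_cube field_simps)
    finally show "\<bar>heat f s (x + h) - heat f s x - a / s * h - b / s\<^sup>2 * h\<^sup>2\<bar> \<le> L * \<bar>h\<bar> ^ 3 / (2 * s\<^sup>2)"
      by (simp add: power_divide)
  qed
qed

section \<open>Upper expectations\<close>

locale prob_family =
  fixes M :: "'a measure" and P :: "'t \<Rightarrow> 'a measure" and \<Theta> :: "'t set"
  assumes nonempty: "\<Theta> \<noteq> {}"
    and prob: "\<And>\<theta>. \<theta> \<in> \<Theta> \<Longrightarrow> prob_space (P \<theta>)"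
    and sets_P: "\<And>\<theta>. \<theta> \<in> \<Theta> \<Longrightarrow> sets (P \<theta>) = sets M"
begin

text \<open>A real-valued copy of \<open>sublinear_expectation\<close> on which ordinary arithmetic
  works; the two agree on \<open>admissible\<close> functions.\<close>

definition upper_exp :: "('a \<Rightarrow> real) \<Rightarrow> real" where
  "upper_exp f = (SUP \<theta>\<in>\<Theta>. \<integral>w. f w \<partial>P \<theta>)"

text \<open>Integrability under each single measure could still leave an infinite supremum. A bound
  on the absolute moment that is uniform in \<open>\<theta>\<close> makes the upper expectations of
  \<open>f\<close> and of \<open>- f\<close> finite together, and it survives domination and linear
  combinations.\<close>

definition admissible :: "('a \<Rightarrow> real) \<Rightarrow> bool" where
  "admissible f \<longleftrightarrow> f \<in> borel_measurable M \<and>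
     (\<exists>C. \<forall>\<theta>\<in>\<Theta>. integrable (P \<theta>) f \<and> (\<integral>w. \<bar>f w\<bar> \<partial>P \<theta>) \<le> C)"

lemma measurable_P: "f \<in> borel_measurable M \<Longrightarrow> \<theta> \<in> \<Theta> \<Longrightarrow> f \<in> borel_measurable (P \<theta>)"
  using measurable_cong_sets[OF sets_P refl] by blast

lemma admissible_integrable: "admissible f \<Longrightarrow> \<theta> \<in> \<Theta> \<Longrightarrow> integrable (P \<theta>) f"
  by (auto simp: admissible_def)

lemma admissible_bound:
  assumes "admissible f" "g \<in> borel_measurable M" "\<And>w. \<bar>g w\<bar> \<le> f w"
  shows "admissible g"
proof -
  obtain C where C: "\<And>\<theta>. \<theta> \<in> \<Theta> \<Longrightarrow> integrable (P \<theta>) f \<and> (\<integral>w. \<bar>f w\<bar> \<partial>P \<theta>) \<le> C"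
    using assms(1) by (auto simp: admissible_def)
  have le: "\<bar>g w\<bar> \<le> \<bar>f w\<bar>" for w
    using assms(3) abs_ge_self by (rule order_trans)
  have "integrable (P \<theta>) g \<and> (\<integral>w. \<bar>g w\<bar> \<partial>P \<theta>) \<le> C" if "\<theta> \<in> \<Theta>" for \<theta>
  proof
    show I: "integrable (P \<theta>) g"
      using C[OF that] measurable_P[OF assms(2) that] le
      by (intro Bochner_Integration.integrable_bound[of _ f g]) auto
    have "(\<integral>w. \<bar>g w\<bar> \<partial>P \<theta>) \<le> (\<integral>w. \<bar>f w\<bar> \<partial>P \<theta>)"
      using I C[OF that] le by (intro integral_mono) auto
    with C[OF that] show "(\<integral>w. \<bar>g w\<bar> \<partial>P \<theta>) \<le> C" by simp
  qed
  with assms(2) show ?thesis by (auto simp: admissible_def)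
qed

lemma admissible_const [intro, simp]: "admissible (\<lambda>w. k)"
proof -
  have "integrable (P \<theta>) (\<lambda>w. k) \<and> (\<integral>w. \<bar>k\<bar> \<partial>P \<theta>) \<le> \<bar>k\<bar>" if "\<theta> \<in> \<Theta>" for \<theta>
  proof -
    interpret prob_space "P \<theta>" using prob[OF that] .
    show ?thesis using prob_space by simp
  qed
  then show ?thesis by (auto simp: admissible_def)
qed

lemma admissible_add [intro]:
  assumes "admissible f" "admissible g"
  shows "admissible (\<lambda>w. f w + g w)"
proof -
  obtain C where C: "\<And>\<theta>. \<theta> \<in> \<Theta> \<Longrightarrow> integrable (P \<theta>) f \<and> (\<integral>w. \<bar>f w\<bar> \<partial>P \<theta>) \<le> C"
    using assms(1) by (auto simp: admissible_def)
  obtain D where D: "\<And>\<theta>. \<theta> \<in> \<Theta> \<Longrightarrow> integrable (P \<theta>) g \<and> (\<integral>w. \<bar>g w\<bar> \<partial>P \<theta>) \<le> D"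
    using assms(2) by (auto simp: admissible_def)
  have "integrable (P \<theta>) (\<lambda>w. f w + g w) \<and> (\<integral>w. \<bar>f w + g w\<bar> \<partial>P \<theta>) \<le> C + D" if "\<theta> \<in> \<Theta>" for \<theta>
  proof
    show I: "integrable (P \<theta>) (\<lambda>w. f w + g w)"
      using C[OF that] D[OF that] by auto
    have "(\<integral>w. \<bar>f w + g w\<bar> \<partial>P \<theta>) \<le> (\<integral>w. \<bar>f w\<bar> + \<bar>g w\<bar> \<partial>P \<theta>)"
      using I C[OF that] D[OF that] by (intro integral_mono) auto
    also have "\<dots> = (\<integral>w. \<bar>f w\<bar> \<partial>P \<theta>) + (\<integral>w. \<bar>g w\<bar> \<partial>P \<theta>)"
      using C[OF that] D[OF that] by (intro Bochner_Integration.integral_add) auto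
    finally show "(\<integral>w. \<bar>f w + g w\<bar> \<partial>P \<theta>) \<le> C + D"
      using C[OF that] D[OF that] by simp
  qed
  with assms show ?thesis by (auto simp: admissible_def)
qed

lemma admissible_cmult [intro]:
  assumes "admissible f"
  shows "admissible (\<lambda>w. k * f w)"
proof -
  obtain C where C: "\<And>\<theta>. \<theta> \<in> \<Theta> \<Longrightarrow> integrable (P \<theta>) f \<and> (\<integral>w. \<bar>f w\<bar> \<partial>P \<theta>) \<le> C"
    using assms(1) by (auto simp: admissible_def)
  have "integrable (P \<theta>) (\<lambda>w. k * f w) \<and> (\<integral>w. \<bar>k * f w\<bar> \<partial>P \<theta>) \<le> \<bar>k\<bar> * C" if "\<theta> \<in> \<Theta>" for \<theta>
    using C[OF that] by (auto simp: abs_mult intro: mult_left_mono)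
  with assms show ?thesis by (auto simp: admissible_def)
qed

lemma admissible_bounded:
  assumes "f \<in> borel_measurable M" "\<And>w. \<bar>f w\<bar> \<le> B"
  shows "admissible f"
  by (rule admissible_bound[OF admissible_const[of B]]) (fact assms)+

lemma admissible_bdd_above:
  assumes "admissible f"
  shows "bdd_above ((\<lambda>\<theta>. \<integral>w. f w \<partial>P \<theta>) ` \<Theta>)"
proof -
  obtain C where "\<And>\<theta>. \<theta> \<in> \<Theta> \<Longrightarrow> (\<integral>w. \<bar>f w\<bar> \<partial>P \<theta>) \<le> C"
    using assms by (auto simp: admissible_def)
  then have "(\<integral>w. f w \<partial>P \<theta>) \<le> C" if "\<theta> \<in> \<Theta>" for \<theta>
    using integral_abs_bound[of "P \<theta>" f] that by (smt (verit))
  then show ?thesis by (auto simp: bdd_above_def)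
qed

lemma upper_exp_upper: "admissible f \<Longrightarrow> \<theta> \<in> \<Theta> \<Longrightarrow> (\<integral>w. f w \<partial>P \<theta>) \<le> upper_exp f"
  unfolding upper_exp_def by (intro cSUP_upper admissible_bdd_above)

lemma upper_exp_least: "(\<And>\<theta>. \<theta> \<in> \<Theta> \<Longrightarrow> (\<integral>w. f w \<partial>P \<theta>) \<le> C) \<Longrightarrow> upper_exp f \<le> C"
  unfolding upper_exp_def by (intro cSUP_least nonempty)

lemma upper_exp_const: "upper_exp (\<lambda>w. k) = k"
proof -
  have "(\<integral>w. k \<partial>P \<theta>) = k" if "\<theta> \<in> \<Theta>" for \<theta>
    using prob_space.prob_space[OF prob[OF that]] by simp
  then have "upper_exp (\<lambda>w. k) = (SUP \<theta>\<in>\<Theta>. k)"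
    unfolding upper_exp_def by (intro SUP_cong refl)
  then show ?thesis using nonempty by simp
qed

lemma sublinear_expectation_eq:
  assumes "admissible f"
  shows "sublinear_expectation P \<Theta> f = ereal (upper_exp f)"
proof -
  have "sublinear_expectation P \<Theta> f = (SUP \<theta>\<in>\<Theta>. ereal (\<integral>w. f w \<partial>P \<theta>))"
    unfolding sublinear_expectation_def
    using admissible_integrable[OF assms] by (intro SUP_cong refl ext_expectation_integrable)
  also have "\<dots> = ereal (upper_exp f)"
  proof (rule antisym)
    show "(SUP \<theta>\<in>\<Theta>. ereal (\<integral>w. f w \<partial>P \<theta>)) \<le> ereal (upper_exp f)"
      using upper_exp_upper[OF assms] by (intro SUP_least) simp
    have fin: "\<bar>SUP \<theta>\<in>\<Theta>. ereal (\<integral>w. f w \<partial>P \<theta>)\<bar> \<noteq> \<infinity>"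
    proof -
      obtain \<theta> where \<theta>: "\<theta> \<in> \<Theta>" using nonempty by blast
      have "ereal (\<integral>w. f w \<partial>P \<theta>) \<le> (SUP \<theta>\<in>\<Theta>. ereal (\<integral>w. f w \<partial>P \<theta>))"
        by (rule SUP_upper[OF \<theta>])
      moreover have "(SUP \<theta>\<in>\<Theta>. ereal (\<integral>w. f w \<partial>P \<theta>)) \<le> ereal (upper_exp f)"
        using upper_exp_upper[OF assms] by (intro SUP_least) simp
      ultimately show ?thesis by auto
    qed
    then obtain s where s: "(SUP \<theta>\<in>\<Theta>. ereal (\<integral>w. f w \<partial>P \<theta>)) = ereal s" by auto
    have "(\<integral>w. f w \<partial>P \<theta>) \<le> s" if "\<theta> \<in> \<Theta>" for \<theta>
      using SUP_upper[OF that, of "\<lambda>\<theta>. ereal (\<integral>w. f w \<partial>P \<theta>)"] s by simp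
    then show "ereal (upper_exp f) \<le> (SUP \<theta>\<in>\<Theta>. ereal (\<integral>w. f w \<partial>P \<theta>))"
      unfolding s by (simp add: upper_exp_least)
  qed
  finally show ?thesis .
qed

text \<open>Subadditivity and monotonicity combined. Every pointwise error of the argument
  (clamping, Taylor remainder, replacement step) is transferred to upper expectations in this
  form.\<close>

lemma upper_exp_diff_le:
  assumes f: "admissible f" and g: "admissible g" and h: "admissible h" and "0 \<le> k"
    and le: "\<And>w. \<bar>f w - g w\<bar> \<le> k * h w"
  shows "\<bar>upper_exp f - upper_exp g\<bar> \<le> k * upper_exp h"
proof -
  have *: "upper_exp f \<le> upper_exp g + k * upper_exp h"
    if f: "admissible f" and g: "admissible g" and le: "\<And>w. \<bar>f w - g w\<bar> \<le> k * h w" for f g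
  proof (rule upper_exp_least)
    fix \<theta> assume \<theta>: "\<theta> \<in> \<Theta>"
    note I = f[THEN admissible_integrable, OF \<theta>] g[THEN admissible_integrable, OF \<theta>]
      h[THEN admissible_integrable, OF \<theta>]
    have "f w \<le> g w + k * h w" for w
      using le[of w] by simp
    then have "(\<integral>w. f w \<partial>P \<theta>) \<le> (\<integral>w. g w + k * h w \<partial>P \<theta>)"
      using I by (intro integral_mono) auto
    also have "\<dots> = (\<integral>w. g w \<partial>P \<theta>) + k * (\<integral>w. h w \<partial>P \<theta>)"
      using I by simp
    also have "\<dots> \<le> upper_exp g + k * upper_exp h"
      using \<open>0 \<le> k\<close> g h \<theta> by (intro add_mono mult_left_mono upper_exp_upper)
    finally show "(\<integral>w. f w \<partial>P \<theta>) \<le> upper_exp g + k * upper_exp h" .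
  qed
  from *[OF f g le] *[OF g f] le show ?thesis
    by (simp add: abs_minus_commute)
qed

text \<open>Linear growth is dominated by quadratic growth. The square is included because it
  controls the error of clamping \<open>v\<close>.\<close>

lemma admissible_lipschitz:
  assumes v: "L-lipschitz_on UNIV v" and R: "R \<in> borel_measurable M" "admissible (\<lambda>w. (R w)\<^sup>2)"
  shows "admissible (\<lambda>w. v (R w))" "admissible (\<lambda>w. (v (R w))\<^sup>2)"
proof -
  have [measurable]: "R \<in> borel_measurable M" "v \<in> borel_measurable borel"
    by (rule R, rule lipschitz_measurable[OF v])
  have L: "0 \<le> L" using v by (simp add: lipschitz_real_iff)
  have growth: "\<bar>v y\<bar> \<le> \<bar>v 0\<bar> + L * \<bar>y\<bar>" for y
    using lipschitz_growth[OF v, of 0 y] by simp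
  have "\<bar>y\<bar> \<le> 1 + y\<^sup>2" for y :: real
    using zero_le_power2[of "\<bar>y\<bar> - 1"] zero_le_power2[of y] by (simp add: power2_diff)
  then have "\<bar>v y\<bar> \<le> \<bar>v 0\<bar> + L * (1 + y\<^sup>2)" for y
    by (rule order_trans[OF growth add_left_mono[OF mult_left_mono[OF _ L]]])
  moreover have adm: "admissible (\<lambda>w. \<bar>v 0\<bar> + L * (1 + (R w)\<^sup>2))"
    by (intro admissible_add admissible_cmult admissible_const R)
  ultimately show "admissible (\<lambda>w. v (R w))"
    by (intro admissible_bound[OF adm]) measurable
  have "(v y)\<^sup>2 \<le> 2 * (v 0)\<^sup>2 + 2 * L\<^sup>2 * y\<^sup>2" for y
  proof -
    have "(v y)\<^sup>2 = \<bar>v y\<bar>\<^sup>2" by simp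
    also have "\<dots> \<le> (\<bar>v 0\<bar> + L * \<bar>y\<bar>)\<^sup>2"
      by (intro power_mono growth) simp
    also have "\<dots> \<le> 2 * \<bar>v 0\<bar>\<^sup>2 + 2 * (L * \<bar>y\<bar>)\<^sup>2"
      using zero_le_power2[of "\<bar>v 0\<bar> - L * \<bar>y\<bar>"] unfolding power2_sum power2_diff by simp
    finally show ?thesis by (simp add: power_mult_distrib)
  qed
  moreover have adm': "admissible (\<lambda>w. 2 * (v 0)\<^sup>2 + 2 * L\<^sup>2 * (R w)\<^sup>2)"
    by (intro admissible_add admissible_cmult admissible_const R)
  ultimately show "admissible (\<lambda>w. (v (R w))\<^sup>2)"
    by (intro admissible_bound[OF adm']) (auto simp only: abs_power2, measurable)
qed

lemma admissible_square_add:
  assumes [measurable]: "Q \<in> borel_measurable M" "R \<in> borel_measurable M"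
    and "admissible (\<lambda>w. (Q w)\<^sup>2)" "admissible (\<lambda>w. (R w)\<^sup>2)"
  shows "admissible (\<lambda>w. (Q w + R w)\<^sup>2)"
proof (rule admissible_bound)
  show "admissible (\<lambda>w. 2 * (Q w)\<^sup>2 + 2 * (R w)\<^sup>2)"
    by (intro admissible_add admissible_cmult assms)
  have "(Q w + R w)\<^sup>2 \<le> 2 * (Q w)\<^sup>2 + 2 * (R w)\<^sup>2" for w
    using zero_le_power2[of "Q w - R w"] unfolding power2_sum power2_diff by simp
  then show "\<bar>(Q w + R w)\<^sup>2\<bar> \<le> 2 * (Q w)\<^sup>2 + 2 * (R w)\<^sup>2" for w
    by (simp only: abs_power2)
qed measurable

text \<open>Equality in distribution only speaks about bounded functions. Truncating
  \<open>g\<close> at level \<open>m\<close> transfers the bound from \<open>W\<close> to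
  \<open>U\<close>, and monotone convergence under each measure removes the truncation.\<close>

lemma admissible_identically_distributed:
  assumes id: "identically_distributed (sublinear_expectation P \<Theta>) U W"
    and [measurable]: "U \<in> borel_measurable M" "W \<in> borel_measurable M"
    and g: "continuous_on UNIV g" "\<And>x. 0 \<le> g x" and W: "admissible (\<lambda>w. g (W w))"
  shows "admissible (\<lambda>w. g (U w))"
proof -
  have [measurable]: "g \<in> borel_measurable borel"
    by (rule borel_measurable_continuous_onI[OF g(1)])
  let ?C = "upper_exp (\<lambda>w. g (W w))"
  have fin: "(\<integral>\<^sup>+w. ennreal (g (U w)) \<partial>P \<theta>) \<le> ennreal ?C" if \<theta>: "\<theta> \<in> \<Theta>" for \<theta>
  proof -
    interpret prob_space "P \<theta>" using prob[OF \<theta>] .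
    have [measurable]: "U \<in> borel_measurable (P \<theta>)"
      by (rule measurable_P[OF _ \<theta>]) measurable
    define t where "t m x = min (g x) (real m)" for m :: nat and x
    have t: "0 \<le> t m x" "t m x \<le> real m" "t m x \<le> g x" for m x
      using g(2) by (auto simp: t_def)
    have [measurable]: "t m \<in> borel_measurable borel" for m
      unfolding t_def by measurable
    have adm: "admissible (\<lambda>w. t m (R w))" if [measurable]: "R \<in> borel_measurable M" for m R
      using t by (intro admissible_bounded[of _ "real m"]) auto
    have eq: "upper_exp (\<lambda>w. t m (U w)) = upper_exp (\<lambda>w. t m (W w))" for m
    proof -
      have "continuous_on UNIV (t m)"
        unfolding t_def by (intro continuous_intros g)
      moreover have "bounded (range (t m))"
        using t by (auto simp: bounded_iff intro!: exI[of _ "real m"])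
      ultimately have "sublinear_expectation P \<Theta> (\<lambda>w. t m (U w)) = sublinear_expectation P \<Theta> (\<lambda>w. t m (W w))"
        using id unfolding identically_distributed_def by blast
      then show ?thesis
        using adm[of U m] adm[of W m] assms(2,3) by (simp add: sublinear_expectation_eq)
    qed
    have le: "(\<integral>\<^sup>+w. ennreal (t m (U w)) \<partial>P \<theta>) \<le> ennreal ?C" for m
    proof -
      have "(\<integral>w. t m (U w) \<partial>P \<theta>) \<le> upper_exp (\<lambda>w. t m (W w))"
        unfolding eq[symmetric] using adm[of U m] assms(2) \<theta> by (intro upper_exp_upper)
      also have "\<dots> \<le> ?C"
      proof (rule upper_exp_least)
        fix \<theta>' assume \<theta>': "\<theta>' \<in> \<Theta>"
        have "(\<integral>w. t m (W w) \<partial>P \<theta>') \<le> (\<integral>w. g (W w) \<partial>P \<theta>')"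
          using adm[of W m] assms(3) W \<theta>' t
          by (intro integral_mono admissible_integrable) auto
        also have "\<dots> \<le> ?C" by (rule upper_exp_upper[OF W \<theta>'])
        finally show "(\<integral>w. t m (W w) \<partial>P \<theta>') \<le> ?C" .
      qed
      finally have "(\<integral>w. t m (U w) \<partial>P \<theta>) \<le> ?C" .
      moreover have "(\<integral>\<^sup>+w. ennreal (t m (U w)) \<partial>P \<theta>) = ennreal (\<integral>w. t m (U w) \<partial>P \<theta>)"
        using adm[of U m] assms(2) \<theta> t by (intro nn_integral_eq_integral admissible_integrable) auto
      ultimately show ?thesis by (simp add: ennreal_leI)
    qed
    have sup: "(SUP m. ennreal (t m x)) = ennreal (g x)" for x
    proof (rule antisym)
      show "(SUP m. ennreal (t m x)) \<le> ennreal (g x)"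
        using t by (intro SUP_least ennreal_leI)
      obtain m where "g x \<le> real m" using real_arch_simple by blast
      then have "ennreal (g x) = ennreal (t m x)" by (simp add: t_def)
      also have "\<dots> \<le> (SUP m. ennreal (t m x))" by (rule SUP_upper) simp
      finally show "ennreal (g x) \<le> (SUP m. ennreal (t m x))" .
    qed
    have "(\<integral>\<^sup>+w. ennreal (g (U w)) \<partial>P \<theta>) = (\<integral>\<^sup>+w. (SUP m. ennreal (t m (U w))) \<partial>P \<theta>)"
      by (simp add: sup)
    also have "\<dots> = (SUP m. (\<integral>\<^sup>+w. ennreal (t m (U w)) \<partial>P \<theta>))"
      by (intro nn_integral_monotone_convergence_SUP) (auto simp: incseq_def le_fun_def t_def intro!: ennreal_leI)
    also have "\<dots> \<le> ennreal ?C"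
      by (intro SUP_least le)
    finally show ?thesis .
  qed
  have C: "0 \<le> ?C"
  proof -
    obtain \<theta> where \<theta>: "\<theta> \<in> \<Theta>" using nonempty by blast
    have "0 \<le> (\<integral>w. g (W w) \<partial>P \<theta>)" using g by simp
    also have "\<dots> \<le> ?C" by (rule upper_exp_upper[OF W \<theta>])
    finally show ?thesis .
  qed
  have "integrable (P \<theta>) (\<lambda>w. g (U w)) \<and> (\<integral>w. \<bar>g (U w)\<bar> \<partial>P \<theta>) \<le> ?C" if \<theta>: "\<theta> \<in> \<Theta>" for \<theta>
  proof
    have [measurable]: "U \<in> borel_measurable (P \<theta>)"
      by (rule measurable_P[OF _ \<theta>]) measurable
    show I: "integrable (P \<theta>) (\<lambda>w. g (U w))"
      using fin[OF \<theta>] g(2) by (intro integrableI_bounded) (auto simp: le_less_trans)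
    have "ennreal (\<integral>w. g (U w) \<partial>P \<theta>) \<le> ennreal ?C"
      using fin[OF \<theta>] nn_integral_eq_integral[OF I] g(2) by simp
    then show "(\<integral>w. \<bar>g (U w)\<bar> \<partial>P \<theta>) \<le> ?C"
      using C g(2) by (simp add: ennreal_le_iff)
  qed
  then show ?thesis by (auto simp: admissible_def)
qed

end

section \<open>Partial sums of an i.i.d. sequence\<close>

declare One_nat_def [simp del]

text \<open>Beyond the level \<open>m\<close> the error is \<open>\<bar>y\<bar> - m\<close>, and the
  constant 4 comes from \<open>(\<bar>y\<bar> - 2 * m)\<^sup>2 \<ge> 0\<close>. An error of order
  \<open>y\<^sup>2 / m\<close> vanishes for large \<open>m\<close> given second moments
  alone.\<close>

lemma clamp_approx:
  fixes y :: real
  assumes "0 < m"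
  shows "\<bar>y - max (- m) (min m y)\<bar> \<le> y\<^sup>2 / (4 * m)"
proof (cases "\<bar>y\<bar> \<le> m")
  case True
  then have "max (- m) (min m y) = y" by auto
  then show ?thesis using assms by simp
next
  case False
  have "0 \<le> (\<bar>y\<bar> - 2 * m)\<^sup>2" by simp
  then have "(\<bar>y\<bar> - m) * (4 * m) \<le> y\<^sup>2"
    by (simp add: power2_diff power2_eq_square algebra_simps)
  then have "\<bar>y\<bar> - m \<le> y\<^sup>2 / (4 * m)"
    using assms by (simp add: pos_le_divide_eq)
  then show ?thesis using False assms by (simp add: min_def max_def abs_if split: if_splits)
qed

text \<open>Separates the two increments, so that a bound obtained by averaging over
  \<open>y\<close> can be averaged once more over \<open>x\<close>.\<close>

lemma lipschitz_square_growth: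
  fixes v :: "real \<Rightarrow> real"
  assumes v: "L-lipschitz_on UNIV v"
  shows "(v (x + y))\<^sup>2 \<le> 3 * (v 0)\<^sup>2 + 3 * L\<^sup>2 * x\<^sup>2 + 3 * L\<^sup>2 * y\<^sup>2"
proof -
  have L: "0 \<le> L" using v by (simp add: lipschitz_real_iff)
  have "\<bar>v (x + y)\<bar> \<le> \<bar>v x\<bar> + L * \<bar>y\<bar>" "\<bar>v x\<bar> \<le> \<bar>v 0\<bar> + L * \<bar>x\<bar>"
    using lipschitz_growth[OF v, of x y] lipschitz_growth[OF v, of 0 x] by simp_all
  then have "\<bar>v (x + y)\<bar>\<^sup>2 \<le> (\<bar>v 0\<bar> + L * \<bar>x\<bar> + L * \<bar>y\<bar>)\<^sup>2"
    by (intro power_mono) auto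
  also have "\<dots> \<le> 3 * \<bar>v 0\<bar>\<^sup>2 + 3 * (L * \<bar>x\<bar>)\<^sup>2 + 3 * (L * \<bar>y\<bar>)\<^sup>2"
    using zero_le_power2[of "\<bar>v 0\<bar> - L * \<bar>x\<bar>"] zero_le_power2[of "\<bar>v 0\<bar> - L * \<bar>y\<bar>"]
      zero_le_power2[of "L * \<bar>x\<bar> - L * \<bar>y\<bar>"]
    unfolding power2_sum power2_diff by (simp add: distrib_right)
  finally show ?thesis by (simp add: power_mult_distrib)
qed

text \<open>\<open>c\<close> stands for the normalising factor
  \<open>1 / (\<sigma> * sqrt n)\<close>. It is left free here, so that the same recursion serves
  the upper and the lower deviation.\<close>

locale iid_sum = prob_family M P \<Theta>
  for M :: "'a measure" and P :: "'t \<Rightarrow> 'a measure" and \<Theta> :: "'t set" +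
  fixes X :: "nat \<Rightarrow> 'a \<Rightarrow> real" and n :: nat and \<mu> c :: real
  assumes n: "1 \<le> n"
    and X_measurable: "\<And>i. i \<in> {1..n} \<Longrightarrow> X i \<in> borel_measurable M"
    and X_iid: "iid (sublinear_expectation P \<Theta>) n X"
    and X_square: "admissible (\<lambda>w. (X 1 w - \<mu>)\<^sup>2)"
begin

definition U :: "nat \<Rightarrow> 'a \<Rightarrow> real" where
  "U i w = c * (X i w - \<mu>)"

definition S :: "nat \<Rightarrow> 'a \<Rightarrow> real" where
  "S k w = (\<Sum>i<k. U (Suc i) w)"

text \<open>The conditional upper expectation of \<open>v\<close> at the next partial sum, given
  that the present one is \<open>x\<close>: one step of backward dynamic programming. By equality in
  distribution \<open>U 1\<close> can represent every summand.\<close>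

definition step :: "(real \<Rightarrow> real) \<Rightarrow> real \<Rightarrow> real" where
  "step v x = upper_exp (\<lambda>w. v (x + U 1 w))"

lemma U_measurable: "i \<in> {1..n} \<Longrightarrow> U i \<in> borel_measurable M"
  unfolding U_def[abs_def] using X_measurable by measurable

lemma U_1_measurable [measurable]: "U 1 \<in> borel_measurable M"
  using U_measurable n by simp

lemma S_measurable: "k \<le> n \<Longrightarrow> S k \<in> borel_measurable M"
  unfolding S_def[abs_def] by (intro borel_measurable_sum U_measurable) auto

lemma U_square:
  assumes i: "i \<in> {1..n}"
  shows "admissible (\<lambda>w. (U i w)\<^sup>2)"
proof -
  have "admissible (\<lambda>w. (X i w - \<mu>)\<^sup>2)"
  proof (cases "i = 1")
    case True
    then show ?thesis using X_square by simp
  next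
    case False
    then obtain j where j: "i = Suc j" "j \<in> {1..<n}"
      using i by (cases i) auto
    then have id: "identically_distributed (sublinear_expectation P \<Theta>) (X i) (X 1)"
      using X_iid by (auto simp: iid_def)
    have "X 1 \<in> borel_measurable M"
      using n by (intro X_measurable) simp
    then show ?thesis
      by (rule admissible_identically_distributed[OF id X_measurable[OF i], of "\<lambda>x. (x - \<mu>)\<^sup>2"])
        (auto intro!: continuous_intros X_square)
  qed
  then have "admissible (\<lambda>w. c\<^sup>2 * (X i w - \<mu>)\<^sup>2)"
    by (rule admissible_cmult)
  then show ?thesis by (simp add: U_def power_mult_distrib)
qed

lemma S_square: "k \<le> n \<Longrightarrow> admissible (\<lambda>w. (S k w)\<^sup>2)"
proof (induction k)
  case 0
  then show ?case by (simp add: S_def)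
next
  case (Suc k)
  have "S (Suc k) w = S k w + U (Suc k) w" for w
    by (simp add: S_def)
  then show ?case
    using Suc by (simp add: admissible_square_add S_measurable U_measurable U_square)
qed

lemma U_shift_square: "admissible (\<lambda>w. (x + U 1 w)\<^sup>2)"
  using n by (intro admissible_square_add U_square U_1_measurable) auto

lemma admissible_S:
  assumes "L-lipschitz_on UNIV v" "k \<le> n"
  shows "admissible (\<lambda>w. v (S k w))" "admissible (\<lambda>w. (v (S k w))\<^sup>2)"
  using admissible_lipschitz[OF assms(1) S_measurable[OF assms(2)] S_square[OF assms(2)]] .

lemma admissible_U:
  assumes "L-lipschitz_on UNIV v"
  shows "admissible (\<lambda>w. v (x + U 1 w))" "admissible (\<lambda>w. (v (x + U 1 w))\<^sup>2)"
proof -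
  have "(\<lambda>w. x + U 1 w) \<in> borel_measurable M" by measurable
  from admissible_lipschitz[OF assms this U_shift_square]
  show "admissible (\<lambda>w. v (x + U 1 w))" "admissible (\<lambda>w. (v (x + U 1 w))\<^sup>2)" .
qed

lemma step_lipschitz:
  assumes v: "L-lipschitz_on UNIV v"
  shows "L-lipschitz_on UNIV (step v)"
  unfolding lipschitz_real_iff
proof (intro conjI allI)
  show L: "0 \<le> L" using v by (simp add: lipschitz_real_iff)
  fix x y
  have "\<bar>step v x - step v y\<bar> \<le> L * \<bar>x - y\<bar> * upper_exp (\<lambda>w. 1)"
    unfolding step_def
  proof (rule upper_exp_diff_le)
    show "\<bar>v (x + U 1 w) - v (y + U 1 w)\<bar> \<le> L * \<bar>x - y\<bar> * 1" for w
      using lipschitz_realD[OF v, of "x + U 1 w" "y + U 1 w"] by simp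
  qed (use L admissible_U[OF v] in auto)
  then show "\<bar>step v x - step v y\<bar> \<le> L * \<bar>x - y\<bar>"
    by (simp add: upper_exp_const)
qed

text \<open>For bounded \<open>v\<close> independence applies directly and freezes the first
  \<open>j\<close> summands; equality in distribution then turns the inner expectation over
  \<open>U (Suc j)\<close> into one over \<open>U 1\<close>.\<close>

lemma upper_exp_S_Suc_bounded:
  assumes lip: "L-lipschitz_on UNIV v" and bound: "\<And>x. \<bar>v x\<bar> \<le> B" and j: "Suc j \<le> n"
  shows "upper_exp (\<lambda>w. v (S (Suc j) w)) = upper_exp (\<lambda>w. step v (S j w))"
proof (cases "j = 0")
  case True
  \<comment> \<open>There is no past to be independent of: \<open>S 0\<close> is the constant 0, and
    the claim is the definition of \<open>step\<close>.\<close>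
  then show ?thesis by (simp add: S_def step_def upper_exp_const One_nat_def)
next
  case False
  then have j': "j \<in> {1..<n}" using j by simp
  let ?EE = "sublinear_expectation P \<Theta>"
  have v: "continuous_on UNIV v"
    by (rule lipschitz_on_continuous_on[OF lip])
  \<comment> \<open>Independence is formulated for the vector of the \<open>X i\<close>, so the
    normalised sum has to be a function of all \<open>Suc j\<close> coordinates.\<close>
  define F where "F z = v (\<Sum>i<Suc j. c * (z i - \<mu>))" for z :: "nat \<Rightarrow> real"
  have "continuous_map (Euclidean_space (j + 1)) euclideanreal (\<lambda>z. z i)" for i
    unfolding Euclidean_space_def
    by (intro continuous_map_from_subtopology continuous_map_product_projection) simp
  then have "continuous_map (Euclidean_space (j + 1)) euclideanreal (\<lambda>z. \<Sum>i<Suc j. c * (z i - \<mu>))"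
    by (intro continuous_intros) auto
  moreover have "continuous_map euclideanreal euclideanreal v"
    using v by simp
  ultimately have "continuous_map (Euclidean_space (j + 1)) euclideanreal F"
    using continuous_map_compose unfolding F_def comp_def by blast
  moreover have "bounded (F ` A)" for A
    using bound by (auto simp: bounded_iff F_def intro!: exI[of _ B])
  ultimately have "bounded_continuous (j + 1) F"
    by (simp add: bounded_continuous_def)
  moreover have "independent_of ?EE 1 (\<lambda>w. vec_of 1 (\<lambda>_. X (Suc j) w)) j (\<lambda>w. vec_of j (\<lambda>i. X (Suc i) w))"
    using X_iid j' by (auto simp: iid_def)
  ultimately have "?EE (\<lambda>w. F (vec_append j (vec_of j (\<lambda>i. X (Suc i) w)) (vec_of 1 (\<lambda>_. X (Suc j) w))))
      = ?EE (\<lambda>w. real_of_ereal (?EE (\<lambda>w'. F (vec_append j (vec_of j (\<lambda>i. X (Suc i) w)) (vec_of 1 (\<lambda>_. X (Suc j) w'))))))"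
    unfolding independent_of_def by blast
  moreover have "F (vec_append j (vec_of j (\<lambda>i. X (Suc i) w)) (vec_of 1 (\<lambda>_. X (Suc j) w'))) = v (S j w + U (Suc j) w')"
    for w w'
    by (simp add: F_def vec_append_def vec_of_def S_def U_def)
  moreover have "?EE (\<lambda>w'. v (x + U (Suc j) w')) = ereal (step v x)" for x
  proof -
    have "identically_distributed ?EE (X (Suc j)) (X 1)"
      using X_iid j' by (auto simp: iid_def)
    moreover have "continuous_on UNIV (\<lambda>y. v (x + c * (y - \<mu>)))"
      by (intro continuous_on_compose2[OF v] continuous_intros) auto
    moreover have "bounded (range (\<lambda>y. v (x + c * (y - \<mu>))))"
      using bound by (auto simp: bounded_iff intro!: exI[of _ B])
    ultimately have "?EE (\<lambda>w'. v (x + U (Suc j) w')) = ?EE (\<lambda>w'. v (x + U 1 w'))"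
      unfolding identically_distributed_def U_def by blast
    also have "\<dots> = ereal (step v x)"
      using admissible_U[OF lip] by (simp add: sublinear_expectation_eq step_def)
    finally show ?thesis .
  qed
  ultimately have "?EE (\<lambda>w. v (S (Suc j) w)) = ?EE (\<lambda>w. step v (S j w))"
    by (simp add: S_def)
  then show ?thesis
    using admissible_S(1)[OF lip j] admissible_S(1)[OF step_lipschitz[OF lip], of j] j
    by (simp add: sublinear_expectation_eq)
qed

text \<open>Clamping \<open>v\<close> at \<open>- m\<close> and \<open>m\<close> makes it bounded
  and keeps its Lipschitz constant. Since second moments are bounded uniformly in
  \<open>\<theta>\<close>, both sides move by at most a constant over \<open>m\<close>, and
  \<open>m\<close> is arbitrary.\<close>

lemma upper_exp_S_Suc:
  assumes v: "L-lipschitz_on UNIV v" and j: "Suc j \<le> n"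
  shows "upper_exp (\<lambda>w. v (S (Suc j) w)) = upper_exp (\<lambda>w. step v (S j w))"
proof -
  have j': "j \<le> n" using j by simp
  define v' where "v' m y = max (- m) (min m (v y))" for m y
  have approx: "\<bar>v y - v' m y\<bar> \<le> 1 / (4 * m) * (v y)\<^sup>2" if "0 < m" for m y
    using clamp_approx[OF that, of "v y"] by (simp add: v'_def)
  have v': "L-lipschitz_on UNIV (v' m)" for m
    unfolding lipschitz_real_iff
  proof (intro conjI allI)
    show "0 \<le> L" using v by (simp add: lipschitz_real_iff)
    fix x y
    show "\<bar>v' m x - v' m y\<bar> \<le> L * \<bar>x - y\<bar>"
      using lipschitz_realD[OF v, of x y] by (simp add: v'_def min_def max_def abs_if split: if_splits)
  qed
  define K where "K = upper_exp (\<lambda>w. (U 1 w)\<^sup>2)"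
  \<comment> \<open>The clamping error of \<open>step v\<close> at \<open>x\<close> depends on
    \<open>x\<close>. \<open>q\<close> bounds it by a quadratic function, which is admissible after
    inserting \<open>x = S j w\<close>.\<close>
  define q where "q y = 3 * (v 0)\<^sup>2 + 3 * L\<^sup>2 * y\<^sup>2 + 3 * L\<^sup>2 * K" for y
  define C where "C = upper_exp (\<lambda>w. (v (S (Suc j) w))\<^sup>2) + upper_exp (\<lambda>w. q (S j w))"
  have step: "\<bar>step v x - step (v' m) x\<bar> \<le> 1 / (4 * m) * q x" if m: "0 < m" for m x
  proof -
    have "\<bar>step v x - step (v' m) x\<bar> \<le> 1 / (4 * m) * upper_exp (\<lambda>w. (v (x + U 1 w))\<^sup>2)"
      unfolding step_def using m
      by (intro upper_exp_diff_le approx admissible_U[OF v] admissible_U[OF v']) auto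
    also have "upper_exp (\<lambda>w. (v (x + U 1 w))\<^sup>2) \<le> q x"
    proof (rule upper_exp_least)
      fix \<theta> assume \<theta>: "\<theta> \<in> \<Theta>"
      interpret prob_space "P \<theta>" using prob[OF \<theta>] .
      have adm: "admissible (\<lambda>w. (U 1 w)\<^sup>2)"
        using n by (intro U_square) simp
      note I = admissible_integrable[OF adm \<theta>]
      have "(\<integral>w. (v (x + U 1 w))\<^sup>2 \<partial>P \<theta>) \<le> (\<integral>w. (3 * (v 0)\<^sup>2 + 3 * L\<^sup>2 * x\<^sup>2) + 3 * L\<^sup>2 * (U 1 w)\<^sup>2 \<partial>P \<theta>)"
        using I admissible_integrable[OF admissible_U(2)[OF v] \<theta>]
        by (intro integral_mono lipschitz_square_growth[OF v]) auto
      also have "\<dots> = 3 * (v 0)\<^sup>2 + 3 * L\<^sup>2 * x\<^sup>2 + 3 * L\<^sup>2 * (\<integral>w. (U 1 w)\<^sup>2 \<partial>P \<theta>)"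
        using I prob_space by simp
      also have "\<dots> \<le> q x"
        unfolding q_def K_def by (intro add_left_mono mult_left_mono upper_exp_upper[OF adm \<theta>]) simp
      finally show "(\<integral>w. (v (x + U 1 w))\<^sup>2 \<partial>P \<theta>) \<le> q x" .
    qed
    finally show ?thesis using m by (simp add: divide_right_mono)
  qed
  have adm_q: "admissible (\<lambda>w. q (S j w))"
    unfolding q_def using S_square[OF j'] by (intro admissible_add admissible_cmult admissible_const)
  have le: "\<bar>upper_exp (\<lambda>w. v (S (Suc j) w)) - upper_exp (\<lambda>w. step v (S j w))\<bar> \<le> C / (4 * m)" if m: "0 < m" for m
  proof -
    have 1: "\<bar>upper_exp (\<lambda>w. v (S (Suc j) w)) - upper_exp (\<lambda>w. v' m (S (Suc j) w))\<bar>
        \<le> 1 / (4 * m) * upper_exp (\<lambda>w. (v (S (Suc j) w))\<^sup>2)"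
      using m by (intro upper_exp_diff_le approx admissible_S[OF v j] admissible_S[OF v' j]) auto
    have 2: "\<bar>upper_exp (\<lambda>w. step v (S j w)) - upper_exp (\<lambda>w. step (v' m) (S j w))\<bar>
        \<le> 1 / (4 * m) * upper_exp (\<lambda>w. q (S j w))"
      using m by (intro upper_exp_diff_le step adm_q admissible_S[OF step_lipschitz[OF v] j']
          admissible_S[OF step_lipschitz[OF v'] j']) auto
    have "upper_exp (\<lambda>w. v' m (S (Suc j) w)) = upper_exp (\<lambda>w. step (v' m) (S j w))"
      by (rule upper_exp_S_Suc_bounded[OF v' _ j, of _ m]) (use m in \<open>auto simp: v'_def\<close>)
    then show ?thesis
      using 1 2 by (simp add: C_def add_divide_distrib)
  qed
  have "\<bar>upper_exp (\<lambda>w. v (S (Suc j) w)) - upper_exp (\<lambda>w. step v (S j w))\<bar> \<le> 0"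
  proof (rule field_le_epsilon)
    fix e :: real assume e: "0 < e"
    \<comment> \<open>The level \<open>m = (\<bar>C\<bar> + 1) / e\<close> brings the error below
      \<open>e\<close>; the summand 1 keeps \<open>m\<close> positive when \<open>C\<close> is
      0.\<close>
    have "C / (4 * ((\<bar>C\<bar> + 1) / e)) = C / (4 * (\<bar>C\<bar> + 1)) * e"
      by simp
    also have "\<dots> \<le> 1 * e"
      using e by (intro mult_right_mono) (auto simp: divide_le_eq)
    finally show "\<bar>upper_exp (\<lambda>w. v (S (Suc j) w)) - upper_exp (\<lambda>w. step v (S j w))\<bar> \<le> 0 + e"
      using le[of "(\<bar>C\<bar> + 1) / e"] e by simp
  qed
  then show ?thesis by simp
qed

end

section \<open>Harmonic sums, second differences and Gaussian increments\<close>

lemma harm_le_ln: "harm (Suc m) \<le> 1 + ln (real (Suc m))"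
proof -
  have "harm (Suc m) - ln (real (Suc m)) \<le> harm (Suc 0) - ln (real (Suc 0))"
    using decseqD[OF decseq_harm_diff_ln, of 0 m] by simp
  then show ?thesis by (simp add: harm_def)
qed

text \<open>In the symmetric second difference, nonnegative by midpoint convexity, the linear terms
  cancel. Division by \<open>h\<^sup>2\<close> leaves \<open>- b \<le> C * h\<close> for every
  \<open>h > 0\<close>.\<close>

lemma convex_taylor_nonneg:
  fixes v :: "real \<Rightarrow> real"
  assumes v: "convex_on UNIV v" and "0 \<le> C"
    and taylor: "\<And>h. \<bar>v (x + h) - v x - a * h - b * h\<^sup>2\<bar> \<le> C * \<bar>h\<bar> ^ 3"
  shows "0 \<le> b"
proof -
  have le: "- b \<le> C * h" if h: "0 < h" for h
  proof -
    have "v ((1 - 1 / 2) *\<^sub>R (x + h) + (1 / 2) *\<^sub>R (x - h)) \<le> (1 - 1 / 2) * v (x + h) + 1 / 2 * v (x - h)"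
      by (rule convex_onD[OF v]) auto
    then have "2 * v x \<le> v (x + h) + v (x - h)"
      by (simp add: field_simps)
    moreover have "v (x + h) - v x - a * h - b * h\<^sup>2 \<le> C * h ^ 3"
      "v (x - h) - v x + a * h - b * h\<^sup>2 \<le> C * h ^ 3"
      using taylor[of h] taylor[of "- h"] h by simp_all
    ultimately have "- b * h\<^sup>2 \<le> C * h * h\<^sup>2"
      by (simp add: power2_eq_square power3_eq_cube mult.assoc)
    then show ?thesis using h by (simp only: mult_le_cancel_right) simp
  qed
  have "- b \<le> 0"
  proof (rule field_le_epsilon)
    fix e :: real assume e: "0 < e"
    have "- b \<le> C * (e / (C + 1))"
      using e \<open>0 \<le> C\<close> by (intro le) simp
    also have "\<dots> \<le> e"
      using e \<open>0 \<le> C\<close> by (simp add: field_simps)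
    finally show "- b \<le> 0 + e" by simp
  qed
  then show ?thesis by simp
qed

text \<open>Meant for the step without smoothing, where no Taylor expansion is available.\<close>

lemma heat_diff_le:
  assumes f: "L-lipschitz_on UNIV f" and t: "0 \<le> t"
  shows "\<bar>heat f t x - f x\<bar> \<le> L * t"
proof -
  interpret prob_space std_gaussian by (rule prob_std_gaussian)
  have L: "0 \<le> L" using f by (simp add: lipschitz_real_iff)
  have I: "integrable std_gaussian (\<lambda>y. \<bar>y\<bar>)"
    using integrable_std_gaussian_power(2)[of 1] by simp
  have "heat f t x - f x = (\<integral>y. f (x + t * y) - f x \<partial>std_gaussian)"
    using integrable_heat[OF f] prob_space by (simp add: heat_def)
  then have "\<bar>heat f t x - f x\<bar> \<le> (\<integral>y. \<bar>f (x + t * y) - f x\<bar> \<partial>std_gaussian)"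
    by (simp only: integral_abs_bound)
  also have "\<dots> \<le> (\<integral>y. L * t * \<bar>y\<bar> \<partial>std_gaussian)"
  proof (rule integral_mono)
    show "\<bar>f (x + t * y) - f x\<bar> \<le> L * t * \<bar>y\<bar>" for y
      using lipschitz_realD[OF f, of "x + t * y" x] t by (simp add: abs_mult)
  qed (use integrable_heat[OF f] I in auto)
  also have "\<dots> = L * t * (\<integral>y. \<bar>y\<bar> \<partial>std_gaussian)" by simp
  also have "\<dots> \<le> L * t * 1"
    using L t by (intro mult_left_mono integral_abs_std_gaussian_le) auto
  finally show ?thesis by simp
qed

text \<open>The Gaussian half of the comparison: mean 0 and variance 1 evaluate the quadratic
  polynomial exactly, and the factor 2 bounds the third absolute moment.\<close>

lemma heat_taylor_diff_le:
  assumes v: "L-lipschitz_on UNIV v" and t: "0 \<le> t" and "0 \<le> C"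
    and taylor: "\<And>h. \<bar>v (x + h) - v x - a * h - b * h\<^sup>2\<bar> \<le> C * \<bar>h\<bar> ^ 3"
  shows "\<bar>heat v t x - (v x + b * t\<^sup>2)\<bar> \<le> 2 * C * t ^ 3"
proof -
  interpret prob_space std_gaussian by (rule prob_std_gaussian)
  have I: "integrable std_gaussian (\<lambda>y. y)" "integrable std_gaussian (\<lambda>y. y\<^sup>2)" "integrable std_gaussian (\<lambda>y. \<bar>y\<bar> ^ 3)"
    using integrable_std_gaussian_power(1)[of 1] integrable_std_gaussian_power by auto
  have J: "integrable std_gaussian (\<lambda>y. v x + a * t * y + b * t\<^sup>2 * y\<^sup>2)"
    using I by simp
  have "(\<integral>y. v x + a * t * y + b * t\<^sup>2 * y\<^sup>2 \<partial>std_gaussian) = v x + b * t\<^sup>2"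
    using I prob_space by (simp add: integral_std_gaussian_moments)
  then have "heat v t x - (v x + b * t\<^sup>2) = (\<integral>y. v (x + t * y) - (v x + a * t * y + b * t\<^sup>2 * y\<^sup>2) \<partial>std_gaussian)"
    unfolding heat_def using integrable_heat[OF v] J by simp
  then have "\<bar>heat v t x - (v x + b * t\<^sup>2)\<bar>
      \<le> (\<integral>y. \<bar>v (x + t * y) - (v x + a * t * y + b * t\<^sup>2 * y\<^sup>2)\<bar> \<partial>std_gaussian)"
    by (simp only: integral_abs_bound)
  also have "\<dots> \<le> (\<integral>y. C * t ^ 3 * \<bar>y\<bar> ^ 3 \<partial>std_gaussian)"
  proof (rule integral_mono)
    show "\<bar>v (x + t * y) - (v x + a * t * y + b * t\<^sup>2 * y\<^sup>2)\<bar> \<le> C * t ^ 3 * \<bar>y\<bar> ^ 3" for y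
      using taylor[of "t * y"] t by (simp add: abs_mult power_mult_distrib algebra_simps)
    show "integrable std_gaussian (\<lambda>y. \<bar>v (x + t * y) - (v x + a * t * y + b * t\<^sup>2 * y\<^sup>2)\<bar>)"
      using integrable_heat[OF v] J by (intro integrable_abs Bochner_Integration.integrable_diff)
  qed (use I in simp)
  also have "\<dots> = C * t ^ 3 * (\<integral>y. \<bar>y\<bar> ^ 3 \<partial>std_gaussian)" by simp
  also have "\<dots> \<le> C * t ^ 3 * 2"
    using \<open>0 \<le> C\<close> t by (intro mult_left_mono integral_abs_std_gaussian_le) auto
  finally show ?thesis by simp
qed

section \<open>Lindeberg replacement\<close>

context iid_sum
begin

lemma admissible_U_abs: "admissible (\<lambda>w. \<bar>U 1 w\<bar>)"
proof -
  have "1-lipschitz_on UNIV (\<lambda>x::real. \<bar>x\<bar>)"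
    by (auto simp: lipschitz_real_iff)
  from admissible_U(1)[OF this, of 0] show ?thesis by simp
qed

text \<open>Without smoothing there are no second-order terms to match, so both averages are
  compared with \<open>f x\<close>: the summand costs \<open>L * r * t\<close>, the Gaussian
  \<open>L * t\<close>.\<close>

lemma step_diff_le:
  assumes f: "L-lipschitz_on UNIV f" and t: "0 \<le> t" and r: "upper_exp (\<lambda>w. \<bar>U 1 w\<bar>) \<le> r * t"
  shows "\<bar>step f x - heat f t x\<bar> \<le> L * (r + 1) * t"
proof -
  have L: "0 \<le> L" using f by (simp add: lipschitz_real_iff)
  have "\<bar>upper_exp (\<lambda>w. f (x + U 1 w)) - upper_exp (\<lambda>w. f x)\<bar> \<le> L * upper_exp (\<lambda>w. \<bar>U 1 w\<bar>)"
  proof (rule upper_exp_diff_le)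
    show "\<bar>f (x + U 1 w) - f x\<bar> \<le> L * \<bar>U 1 w\<bar>" for w
      using lipschitz_realD[OF f, of "x + U 1 w" x] by simp
  qed (use L admissible_U_abs admissible_U[OF f] in auto)
  also have "\<dots> \<le> L * (r * t)"
    by (rule mult_left_mono[OF r L])
  finally have "\<bar>step f x - f x\<bar> \<le> L * (r * t)"
    by (simp add: step_def upper_exp_const)
  with heat_diff_le[OF f t, of x] show ?thesis
    by (simp add: algebra_simps)
qed

text \<open>The sign \<open>sg\<close> is \<open>1\<close> for convex and \<open>-1\<close> for concave functions.\<close>

lemma step_heat_diff_le:
  assumes f: "L-lipschitz_on UNIV f" and s: "0 < s" and t: "0 < t"
    and sg: "\<bar>sg\<bar> = 1" and convex: "convex_on UNIV (\<lambda>x. sg * f x)"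
    and mean: "\<And>\<theta>. \<theta> \<in> \<Theta> \<Longrightarrow> (\<integral>w. U 1 w \<partial>P \<theta>) = 0"
    and var: "\<And>b. 0 \<le> sg * b \<Longrightarrow> upper_exp (\<lambda>w. b * (U 1 w)\<^sup>2) = b * t\<^sup>2"
    and cube: "admissible (\<lambda>w. \<bar>U 1 w\<bar> ^ 3)" "upper_exp (\<lambda>w. \<bar>U 1 w\<bar> ^ 3) \<le> \<beta> * t ^ 3"
  shows "\<bar>step (heat f s) x - heat f (sqrt (s\<^sup>2 + t\<^sup>2)) x\<bar> \<le> L * (\<beta> + 2) * t ^ 3 / (2 * s\<^sup>2)"
proof -
  define v where "v = heat f s"
  have v: "L-lipschitz_on UNIV v"
    unfolding v_def by (rule heat_lipschitz[OF f])
  have L: "0 \<le> L" using f by (simp add: lipschitz_real_iff)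
  define C where "C = L / (2 * s\<^sup>2)"
  have C: "0 \<le> C" using L by (simp add: C_def)
  obtain a b where taylor: "\<And>h. \<bar>v (x + h) - v x - a * h - b * h\<^sup>2\<bar> \<le> C * \<bar>h\<bar> ^ 3"
    using heat_taylor[OF f s, of x] unfolding v_def C_def by auto
  \<comment> \<open>Convexity of \<open>sg * f\<close> survives the heat flow, so \<open>b\<close>
    has the sign for which \<open>var\<close> gives the upper expectation of the quadratic
    term.\<close>
  have "0 \<le> sg * b"
  proof (rule convex_taylor_nonneg[OF _ C])
    have "\<bar>sg * f x - sg * f y\<bar> = \<bar>f x - f y\<bar>" for x y
      using sg by (simp add: abs_mult flip: right_diff_distrib)
    then have "L-lipschitz_on UNIV (\<lambda>x. sg * f x)"
      using f by (simp add: lipschitz_real_iff)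
    moreover have "heat (\<lambda>x. sg * f x) s = (\<lambda>x. sg * v x)"
      by (simp add: heat_def v_def fun_eq_iff)
    ultimately show "convex_on UNIV (\<lambda>x. sg * v x)"
      using heat_convex[OF _ convex, of L s] by simp
    fix h
    have "sg * v (x + h) - sg * v x - (sg * a) * h - (sg * b) * h\<^sup>2 = sg * (v (x + h) - v x - a * h - b * h\<^sup>2)"
      by (simp add: algebra_simps)
    then show "\<bar>sg * v (x + h) - sg * v x - (sg * a) * h - (sg * b) * h\<^sup>2\<bar> \<le> C * \<bar>h\<bar> ^ 3"
      using taylor[of h] sg by (simp add: abs_mult)
  qed
  note var = var[OF this]
  have adm_sq: "admissible (\<lambda>w. (U 1 w)\<^sup>2)"
    using n by (intro U_square) simp
  have adm_U: "admissible (U 1)"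
    by (rule admissible_bound[OF admissible_U_abs]) auto
  have adm_q: "admissible (\<lambda>w. v x + a * U 1 w + b * (U 1 w)\<^sup>2)"
    using adm_sq adm_U by (intro admissible_add admissible_cmult admissible_const)
  \<comment> \<open>An upper expectation does not split in general. Here it does, since the constant
    and linear terms contribute the same amount \<open>v x\<close> under every
    \<open>\<theta>\<close>.\<close>
  have "upper_exp (\<lambda>w. v x + a * U 1 w + b * (U 1 w)\<^sup>2) = v x + b * t\<^sup>2"
  proof -
    have int: "(\<integral>w. v x + a * U 1 w + b * (U 1 w)\<^sup>2 \<partial>P \<theta>) = v x + (\<integral>w. b * (U 1 w)\<^sup>2 \<partial>P \<theta>)" if "\<theta> \<in> \<Theta>" for \<theta>
    proof -
      interpret prob_space "P \<theta>" using prob[OF that] .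
      show ?thesis
        using adm_sq[THEN admissible_integrable, OF that] adm_U[THEN admissible_integrable, OF that]
          mean[OF that] prob_space by simp
    qed
    note adm_b = admissible_cmult[OF adm_sq, of b]
    show ?thesis
    proof (rule antisym)
      show "upper_exp (\<lambda>w. v x + a * U 1 w + b * (U 1 w)\<^sup>2) \<le> v x + b * t\<^sup>2"
        using upper_exp_upper[OF adm_b] by (intro upper_exp_least) (simp add: int var)
      have "upper_exp (\<lambda>w. b * (U 1 w)\<^sup>2) \<le> upper_exp (\<lambda>w. v x + a * U 1 w + b * (U 1 w)\<^sup>2) - v x"
        using upper_exp_upper[OF adm_q] by (intro upper_exp_least) (simp add: int le_diff_eq add.commute)
      then show "v x + b * t\<^sup>2 \<le> upper_exp (\<lambda>w. v x + a * U 1 w + b * (U 1 w)\<^sup>2)"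
        by (simp add: var)
    qed
  qed
  moreover have "\<bar>step v x - upper_exp (\<lambda>w. v x + a * U 1 w + b * (U 1 w)\<^sup>2)\<bar> \<le> C * upper_exp (\<lambda>w. \<bar>U 1 w\<bar> ^ 3)"
    unfolding step_def
  proof (rule upper_exp_diff_le[OF admissible_U(1)[OF v] adm_q cube(1) C])
    show "\<bar>v (x + U 1 w) - (v x + a * U 1 w + b * (U 1 w)\<^sup>2)\<bar> \<le> C * \<bar>U 1 w\<bar> ^ 3" for w
      using taylor[of "U 1 w"] by (simp add: algebra_simps)
  qed
  moreover have "C * upper_exp (\<lambda>w. \<bar>U 1 w\<bar> ^ 3) \<le> C * (\<beta> * t ^ 3)"
    by (rule mult_left_mono[OF cube(2) C])
  moreover have "\<bar>heat v t x - (v x + b * t\<^sup>2)\<bar> \<le> 2 * C * t ^ 3"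
    using t by (intro heat_taylor_diff_le[OF v _ C taylor]) simp
  ultimately have "\<bar>step v x - heat v t x\<bar> \<le> C * (\<beta> * t ^ 3) + 2 * C * t ^ 3"
    by linarith
  also have "\<dots> = L * (\<beta> + 2) * t ^ 3 / (2 * s\<^sup>2)"
    by (simp add: C_def algebra_simps add_divide_distrib)
  also have "heat v t x = heat f (sqrt (s\<^sup>2 + t\<^sup>2)) x"
    unfolding v_def using s t by (intro heat_heat[OF f]) auto
  finally show ?thesis by (simp add: v_def)
qed

text \<open>\<open>r\<close> is the ratio of the upper standard deviation to the normalising one.\<close>

lemma lindeberg_bound:
  assumes f: "L-lipschitz_on UNIV f" and t: "t = 1 / sqrt (real n)"
    and sg: "\<bar>sg\<bar> = 1" and convex: "convex_on UNIV (\<lambda>x. sg * f x)"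
    and mean: "\<And>\<theta>. \<theta> \<in> \<Theta> \<Longrightarrow> (\<integral>w. U 1 w \<partial>P \<theta>) = 0"
    and r: "upper_exp (\<lambda>w. \<bar>U 1 w\<bar>) \<le> r * t" "1 \<le> r"
    and var: "\<And>b. 0 \<le> sg * b \<Longrightarrow> upper_exp (\<lambda>w. b * (U 1 w)\<^sup>2) = b * t\<^sup>2"
    and cube: "admissible (\<lambda>w. \<bar>U 1 w\<bar> ^ 3)" "upper_exp (\<lambda>w. \<bar>U 1 w\<bar> ^ 3) \<le> \<beta> * t ^ 3" "1 \<le> \<beta>"
  shows "\<bar>upper_exp (\<lambda>w. f (S n w)) - heat f 1 0\<bar> \<le> (ln (real n) + 1) / sqrt (real n) * (2 * r + \<beta>) * L"
proof -
  have L: "0 \<le> L" using f by (simp add: lipschitz_real_iff)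
  have t0: "0 < t" and t1: "t * sqrt (real n) = 1" and t2: "t\<^sup>2 = 1 / real n"
    using n by (simp_all add: t power_divide)
  define V where "V k = heat f (t * sqrt (real k))" for k
  have V: "L-lipschitz_on UNIV (V k)" for k
    unfolding V_def by (rule heat_lipschitz[OF f])
  \<comment> \<open>Interpolates between the two sides: the last \<open>k\<close> summands have been
    traded for Gaussian noise of total variance \<open>k / n\<close>.\<close>
  define E where "E k = upper_exp (\<lambda>w. V k (S (n - k) w))" for k
  \<comment> \<open>The cost of trading one more summand. For \<open>k > 0\<close> the factor
    \<open>t ^ 3\<close> meets the inserted variance \<open>k * t\<^sup>2\<close> in the
    denominator.\<close>
  define d where "d k = (if k = 0 then L * (r + 1) * t else L * (\<beta> + 2) * t / 2 * (1 / real k))" for k :: nat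
  have d: "\<bar>step (V k) x - V (Suc k) x\<bar> \<le> d k" for k x
  proof (cases "k = 0")
    case True
    then show ?thesis
      using step_diff_le[OF f less_imp_le[OF t0] r(1), of x] by (simp add: V_def heat_0 d_def)
  next
    case False
    then have s: "0 < t * sqrt (real k)" using t0 by simp
    have "(t * sqrt (real k))\<^sup>2 + t\<^sup>2 = t\<^sup>2 * real (Suc k)"
      by (simp add: power_mult_distrib algebra_simps)
    then have "sqrt ((t * sqrt (real k))\<^sup>2 + t\<^sup>2) = t * sqrt (real (Suc k))"
      using t0 by (simp add: real_sqrt_mult)
    moreover have "L * (\<beta> + 2) * t ^ 3 / (2 * (t * sqrt (real k))\<^sup>2) = d k"
      using t0 False by (simp add: d_def power_mult_distrib power2_eq_square power3_eq_cube)
    ultimately show ?thesis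
      using step_heat_diff_le[OF f s t0 sg convex mean var cube(1,2), of x] by (simp add: V_def)
  qed
  have "\<bar>E k - E (Suc k)\<bar> \<le> d k" if k: "k < n" for k
  proof -
    define j where "j = n - Suc k"
    have j: "Suc j \<le> n" "n - k = Suc j" "n - Suc k = j" "j \<le> n"
      using k by (auto simp: j_def)
    have "\<bar>upper_exp (\<lambda>w. step (V k) (S j w)) - upper_exp (\<lambda>w. V (Suc k) (S j w))\<bar> \<le> d k * upper_exp (\<lambda>w. 1)"
    proof (rule upper_exp_diff_le)
      show "0 \<le> d k" using d[of k 0] by simp
    qed (use d admissible_S[OF step_lipschitz[OF V] j(4)] admissible_S[OF V j(4)] in auto)
    then show ?thesis
      unfolding E_def j(2,3) by (simp add: upper_exp_S_Suc[OF V j(1)] upper_exp_const)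
  qed
  then have "\<bar>E 0 - E m\<bar> \<le> (\<Sum>k<m. d k)" if "m \<le> n" for m
    using that
  proof (induction m)
    case (Suc m)
    then have "\<bar>E 0 - E m\<bar> \<le> (\<Sum>k<m. d k)" "\<bar>E m - E (Suc m)\<bar> \<le> d m" by auto
    then show ?case by simp
  qed simp
  from this[of n] have "\<bar>E 0 - E n\<bar> \<le> (\<Sum>k<n. d k)" by simp
  moreover have "E 0 = upper_exp (\<lambda>w. f (S n w))"
    by (simp add: E_def V_def heat_0)
  moreover have "E n = heat f 1 0"
    by (simp add: E_def V_def t1 S_def upper_exp_const)
  moreover have "(\<Sum>k<n. d k) \<le> (ln (real n) + 1) * (2 * r + \<beta>) * (L * t)"
  proof -
    \<comment> \<open>Step 0 is paid separately, so the harmonic sum ends at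
      \<open>m = n - 1\<close>.\<close>
    obtain m where m: "n = Suc m" using n by (cases n) auto
    have "(\<Sum>k<n. d k) = d 0 + (\<Sum>k<m. d (Suc k))"
      unfolding m by (rule sum.lessThan_Suc_shift)
    also have "(\<Sum>k<m. d (Suc k)) = L * (\<beta> + 2) * t / 2 * harm m"
      by (simp add: d_def harm_altdef sum_distrib_left inverse_eq_divide)
    also have "d 0 + L * (\<beta> + 2) * t / 2 * harm m = ((r + 1) + (\<beta> + 2) / 2 * harm m) * (L * t)"
      by (simp add: d_def algebra_simps add_divide_distrib)
    also have "\<dots> \<le> ((ln (real n) + 1) * (2 * r + \<beta>)) * (L * t)"
    proof (rule mult_right_mono)
      show "0 \<le> L * t" using L t0 by simp
      show "(r + 1) + (\<beta> + 2) / 2 * harm m \<le> (ln (real n) + 1) * (2 * r + \<beta>)"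
      \<comment> \<open>For \<open>n = 1\<close> the harmonic sum is empty and the logarithm
        vanishes, so the claim is \<open>r + 1 \<le> 2 * r + \<beta>\<close>.\<close>
      proof (cases "m = 0")
        case True
        then show ?thesis using r cube by (simp add: m harm_def One_nat_def)
      next
        case False
        then obtain m' where m': "m = Suc m'" by (cases m) auto
        define l where "l = ln (real n)"
        have "harm m \<le> 1 + ln (real m)"
          unfolding m' by (rule harm_le_ln)
        also have "\<dots> \<le> 1 + l"
          unfolding l_def m m' by simp
        finally have harm: "(\<beta> + 2) / 2 * harm m \<le> (\<beta> + 2) / 2 * (1 + l)"
          using cube by (intro mult_left_mono) auto
        \<comment> \<open>With \<open>n \<ge> 2\<close> the crude bound
          \<open>ln n \<ge> 1 - 1 / n\<close> already gives a factor
          \<open>1 + l \<ge> 3 / 2\<close>.\<close>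
        have l: "1 / 2 \<le> l"
        proof -
          have "1 - 1 / real n \<le> l"
            using ln_le_minus_one[of "1 / real n"] n by (simp add: l_def ln_div)
          moreover have "1 / real n \<le> 1 / 2"
            using m m' by (intro divide_left_mono) auto
          ultimately show ?thesis by simp
        qed
        \<comment> \<open>The harmonic part uses up \<open>\<beta> / 2 + 1\<close> of the available
          \<open>2 * r + \<beta>\<close>. The rest is at least \<open>r + 1 / 2\<close>, because
          \<open>r\<close> and \<open>\<beta>\<close> are at least 1, and the factor
          \<open>1 + l\<close> lifts it above the cost of step 0.\<close>
        have "r + 1 \<le> (1 + l) * (2 * r + \<beta> / 2 - 1)"
        proof -
          have "r + 1 \<le> 3 / 2 * (r + 1 / 2)" using r by simp
          also have "\<dots> \<le> (1 + l) * (2 * r + \<beta> / 2 - 1)"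
            using l r cube by (intro mult_mono) auto
          finally show ?thesis .
        qed
        then have "(r + 1) + (\<beta> + 2) / 2 * harm m
            \<le> (1 + l) * (2 * r + \<beta> / 2 - 1) + (\<beta> + 2) / 2 * (1 + l)"
          by (intro add_mono harm)
        also have "\<dots> = (1 + l) * (2 * r + \<beta>)"
          by (simp add: field_simps)
        finally show ?thesis by (simp add: l_def add.commute)
      qed
    qed
    finally show ?thesis by simp
  qed
  ultimately show ?thesis
    by (simp add: t mult_ac)
qed

end

section \<open>From the real-valued estimate to extended-valued moments\<close>

lemma lip_const_lipschitz:
  assumes "\<phi> \<in> lip"
  shows "(lip_const \<phi>)-lipschitz_on UNIV \<phi>"
proof -
  let ?A = "{L. L-lipschitz_on UNIV \<phi>}"
  have ne: "?A \<noteq> {}" using assms by (auto simp: lip_def)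
  have "\<bar>\<phi> x - \<phi> y\<bar> \<le> lip_const \<phi> * \<bar>x - y\<bar>" for x y
  proof (cases "x = y")
    case False
    \<comment> \<open>Every Lipschitz constant is at least this difference quotient, so their
      infimum is again a Lipschitz constant.\<close>
    have "\<bar>\<phi> x - \<phi> y\<bar> / \<bar>x - y\<bar> \<le> lip_const \<phi>"
      unfolding lip_const_def using ne
    proof (rule cInf_greatest)
      fix L assume "L \<in> ?A"
      then show "\<bar>\<phi> x - \<phi> y\<bar> / \<bar>x - y\<bar> \<le> L"
        using False lipschitz_realD[of L \<phi> x y] by (simp add: divide_le_eq)
    qed
    then show ?thesis using False by (simp add: divide_le_eq)
  qed simp
  moreover have "0 \<le> lip_const \<phi>"
    unfolding lip_const_def using ne by (rule cInf_greatest) (auto simp: lipschitz_real_iff)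
  ultimately show ?thesis by (simp add: lipschitz_real_iff)
qed

lemma (in prob_space) integral_std_normal_eq_heat:
  assumes Z: "distributed M lborel Z std_normal_density" and [measurable]: "f \<in> borel_measurable borel"
  shows "(\<integral>v. f (Z v) \<partial>M) = heat f 1 0"
  using distributed_integral[OF Z, of f]
  by (simp add: heat_def integral_density)

lemma (in prob_space) integrable_if_square_integrable:
  fixes Y :: "'a \<Rightarrow> real" and m :: real
  assumes [measurable]: "Y \<in> borel_measurable M" and "integrable M (\<lambda>w. (Y w - m)\<^sup>2)"
  shows "integrable M Y"
proof -
  have "integrable M (\<lambda>w. \<bar>m\<bar> + 1 + (Y w - m)\<^sup>2)"
    using assms by simp
  then show ?thesis
  proof (rule Bochner_Integration.integrable_bound)
    have "\<bar>y\<bar> \<le> \<bar>m\<bar> + 1 + (y - m)\<^sup>2" for y :: real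
      using zero_le_power2[of "\<bar>y - m\<bar> - 1"] by (simp add: power2_diff) (smt (verit) zero_le_power2)
    then show "AE w in M. norm (Y w) \<le> norm (\<bar>m\<bar> + 1 + (Y w - m)\<^sup>2)"
      by (simp add: order_trans[OF _ abs_ge_self])
  qed measurable
qed

context prob_family
begin

text \<open>For a nonnegative function the extended expectation is the absolute moment, so a finite
  supremum is already the uniform bound.\<close>

lemma admissible_nonneg:
  assumes [measurable]: "f \<in> borel_measurable M" and "\<And>w. 0 \<le> f w"
    and "sublinear_expectation P \<Theta> f = ereal s"
  shows "admissible f"
proof -
  have "integrable (P \<theta>) f \<and> (\<integral>w. \<bar>f w\<bar> \<partial>P \<theta>) \<le> s" if \<theta>: "\<theta> \<in> \<Theta>" for \<theta>
  proof
    have [measurable]: "f \<in> borel_measurable (P \<theta>)"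
      by (rule measurable_P[OF _ \<theta>]) measurable
    have "(\<integral>\<^sup>+w. ennreal (- f w) \<partial>P \<theta>) = (\<integral>\<^sup>+w. 0 \<partial>P \<theta>)"
      using assms(2) by (intro nn_integral_cong) (simp add: ennreal_neg)
    then have "enn2ereal (\<integral>\<^sup>+w. ennreal (f w) \<partial>P \<theta>) = ext_expectation (P \<theta>) f"
      by (simp add: ext_expectation_def zero_ennreal.rep_eq)
    also have "\<dots> \<le> ereal s"
      unfolding assms(3)[symmetric] sublinear_expectation_def by (rule SUP_upper[OF \<theta>])
    finally have le: "enn2ereal (\<integral>\<^sup>+w. ennreal (f w) \<partial>P \<theta>) \<le> ereal s" .
    then have "(\<integral>\<^sup>+w. ennreal (f w) \<partial>P \<theta>) < \<infinity>"
      by (cases "(\<integral>\<^sup>+w. ennreal (f w) \<partial>P \<theta>)") auto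
    then show I: "integrable (P \<theta>) f"
      using assms(2) by (intro integrableI_bounded) auto
    have "ext_expectation (P \<theta>) f \<le> ereal s"
      unfolding assms(3)[symmetric] sublinear_expectation_def by (rule SUP_upper[OF \<theta>])
    then show "(\<integral>w. \<bar>f w\<bar> \<partial>P \<theta>) \<le> s"
      using assms(2) by (simp add: ext_expectation_integrable[OF I])
  qed
  then show ?thesis by (auto simp: admissible_def)
qed

lemma upper_exp_cmult:
  assumes f: "admissible f" and "0 \<le> k"
  shows "upper_exp (\<lambda>w. k * f w) = k * upper_exp f"
proof (cases "k = 0")
  case True
  then show ?thesis by (simp add: upper_exp_const)
next
  case False
  with \<open>0 \<le> k\<close> have k: "0 < k" by simp
  show ?thesis
  proof (rule antisym)
    show "upper_exp (\<lambda>w. k * f w) \<le> k * upper_exp f"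
      using upper_exp_upper[OF f] k by (intro upper_exp_least) simp
    have "upper_exp f \<le> upper_exp (\<lambda>w. k * f w) / k"
      using upper_exp_upper[OF admissible_cmult[OF f, of k]] k
      by (intro upper_exp_least) (simp add: pos_le_divide_eq mult.commute)
    then show "k * upper_exp f \<le> upper_exp (\<lambda>w. k * f w)"
      using k by (simp add: pos_le_divide_eq mult.commute)
  qed
qed

text \<open>The common core of both parts: \<open>\<sigma>\<close> is the normalising deviation and
  \<open>r * \<sigma>\<close> the upper one. The convex part takes \<open>r = 1\<close> and
  \<open>sg = 1\<close>, the concave part \<open>r = \<sigma>_up / \<sigma>_low\<close> and
  \<open>sg = - 1\<close>. The variance identity \<open>var\<close> is demanded only for
  coefficients of the sign that can occur.\<close>

lemma clt_bound:
  fixes X :: "nat \<Rightarrow> 'a \<Rightarrow> real" and \<mu> \<sigma> r sg :: real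
  assumes n: "1 \<le> n"
    and X_measurable: "\<And>i. i \<in> {1..n} \<Longrightarrow> X i \<in> borel_measurable M"
    and X_iid: "iid (sublinear_expectation P \<Theta>) n X"
    and square: "admissible (\<lambda>w. (X 1 w - \<mu>)\<^sup>2)"
    and mean: "\<And>\<theta>. \<theta> \<in> \<Theta> \<Longrightarrow> (\<integral>w. X 1 w \<partial>P \<theta>) = \<mu>"
    and \<sigma>: "0 < \<sigma>" and r: "1 \<le> r"
    and var_r: "upper_exp (\<lambda>w. (X 1 w - \<mu>)\<^sup>2) = (r * \<sigma>)\<^sup>2"
    and sg: "\<bar>sg\<bar> = 1"
    and var: "\<And>b. 0 \<le> sg * b \<Longrightarrow> upper_exp (\<lambda>w. b * (X 1 w - \<mu>)\<^sup>2) = b * \<sigma>\<^sup>2"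
    and \<phi>: "\<phi> \<in> lip" "convex_on UNIV (\<lambda>x. sg * \<phi> x)"
    and N: "prob_space N" and Z: "distributed N lborel Z std_normal_density"
  shows "\<bar>sublinear_expectation P \<Theta> (\<lambda>w. \<phi> ((\<Sum>i=1..n. (X i w - \<mu>)) / (\<sigma> * sqrt (real n))))
      - ereal (\<integral>v. \<phi> (Z v) \<partial>N)\<bar>
    \<le> ereal ((ln (real n) + 1) / sqrt (real n))
      * (ereal (2 * r) + sublinear_expectation P \<Theta> (\<lambda>w. \<bar>(X 1 w - \<mu>) / \<sigma>\<bar> ^ 3))
      * ereal (lip_const \<phi>)"
proof -
  define L where "L = lip_const \<phi>"
  have lip: "L-lipschitz_on UNIV \<phi>"
    unfolding L_def by (rule lip_const_lipschitz[OF \<phi>(1)])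
  have L: "0 \<le> L" using lip by (simp add: lipschitz_real_iff)
  define c where "c = 1 / (\<sigma> * sqrt (real n))"
  interpret iid_sum M P \<Theta> X n \<mu> c
    by unfold_locales (use n X_measurable X_iid square in auto)
  have Z_eq: "(\<integral>v. \<phi> (Z v) \<partial>N) = heat \<phi> 1 0"
    by (rule prob_space.integral_std_normal_eq_heat[OF N Z lipschitz_measurable[OF lip]])
  have S_eq: "(\<Sum>i=1..n. (X i w - \<mu>)) / (\<sigma> * sqrt (real n)) = S n w" for w
    unfolding S_def U_def by (simp add: c_def sum.atLeast1_atMost_eq One_nat_def sum_divide_distrib)
  have lhs: "\<bar>sublinear_expectation P \<Theta> (\<lambda>w. \<phi> ((\<Sum>i=1..n. (X i w - \<mu>)) / (\<sigma> * sqrt (real n))))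
      - ereal (\<integral>v. \<phi> (Z v) \<partial>N)\<bar> = ereal \<bar>upper_exp (\<lambda>w. \<phi> (S n w)) - heat \<phi> 1 0\<bar>"
    unfolding S_eq Z_eq using admissible_S(1)[OF lip, of n] by (simp add: sublinear_expectation_eq)
  let ?B = "sublinear_expectation P \<Theta> (\<lambda>w. \<bar>(X 1 w - \<mu>) / \<sigma>\<bar> ^ 3)"
  have factor: "0 < ln (real n) + 1"
    using n by (intro add_nonneg_pos) auto
  have X1 [measurable]: "X 1 \<in> borel_measurable M"
    using n by (intro X_measurable) simp
  have B_nonneg: "0 \<le> ?B"
  proof -
    obtain \<theta> where \<theta>: "\<theta> \<in> \<Theta>" using nonempty by blast
    have "(\<integral>\<^sup>+w. ennreal (- (\<bar>(X 1 w - \<mu>) / \<sigma>\<bar> ^ 3)) \<partial>P \<theta>) = (\<integral>\<^sup>+w. 0 \<partial>P \<theta>)"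
      by (intro nn_integral_cong) (simp add: ennreal_neg)
    then have "0 \<le> ext_expectation (P \<theta>) (\<lambda>w. \<bar>(X 1 w - \<mu>) / \<sigma>\<bar> ^ 3)"
      by (simp add: ext_expectation_def zero_ennreal.rep_eq)
    also have "\<dots> \<le> ?B"
      unfolding sublinear_expectation_def by (rule SUP_upper[OF \<theta>])
    finally show ?thesis .
  qed
  show ?thesis
  proof (cases ?B)
    case (real \<beta>)
    define t where "t = 1 / sqrt (real n)"
    have t: "0 < t" "t\<^sup>2 = 1 / real n" using n by (simp_all add: t_def power_divide)
    have ct: "c * \<sigma> = t" using \<sigma> by (simp add: c_def t_def)
    have U_eq: "U 1 w = t * ((X 1 w - \<mu>) / \<sigma>)" for w
      unfolding U_def using \<sigma> by (simp add: c_def t_def)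
    have adm3: "admissible (\<lambda>w. \<bar>(X 1 w - \<mu>) / \<sigma>\<bar> ^ 3)"
      by (rule admissible_nonneg[OF _ _ real]) auto
    have \<beta>: "upper_exp (\<lambda>w. \<bar>(X 1 w - \<mu>) / \<sigma>\<bar> ^ 3) = \<beta>"
      using real sublinear_expectation_eq[OF adm3] by simp
    have abs3: "\<bar>U 1 w\<bar> ^ 3 = t ^ 3 * \<bar>(X 1 w - \<mu>) / \<sigma>\<bar> ^ 3" for w
      unfolding U_eq abs_mult power_mult_distrib using t by simp
    have sq: "(U 1 w)\<^sup>2 = c\<^sup>2 * (X 1 w - \<mu>)\<^sup>2" for w
      by (simp add: U_def power_mult_distrib)
    have adm_U2: "admissible (\<lambda>w. (U 1 w)\<^sup>2)"
      unfolding sq by (rule admissible_cmult[OF square])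
    have U2: "upper_exp (\<lambda>w. (U 1 w)\<^sup>2) = (r * t)\<^sup>2"
      unfolding sq using upper_exp_cmult[OF square, of "c\<^sup>2"] ct
      by (simp add: var_r power_mult_distrib flip: ct)
    have "0 \<le> t ^ 3" using t by simp
    from upper_exp_cmult[OF adm3 this]
    have cube: "admissible (\<lambda>w. \<bar>U 1 w\<bar> ^ 3)" "upper_exp (\<lambda>w. \<bar>U 1 w\<bar> ^ 3) \<le> \<beta> * t ^ 3"
      unfolding abs3 \<beta> using admissible_cmult[OF adm3] by (simp_all only: mult.commute order_refl)
    \<comment> \<open>Cauchy-Schwarz in the linear form
      \<open>\<bar>u\<bar> \<le> (k + u\<^sup>2 / k) / 2\<close>, with \<open>k = r * t\<close> the
      upper standard deviation of \<open>U 1\<close>.\<close>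
    have abs1: "upper_exp (\<lambda>w. \<bar>U 1 w\<bar>) \<le> r * t"
    proof (rule upper_exp_least)
      fix \<theta> assume \<theta>: "\<theta> \<in> \<Theta>"
      interpret prob_space "P \<theta>" using prob[OF \<theta>] .
      note I = admissible_integrable[OF adm_U2 \<theta>] admissible_integrable[OF admissible_U_abs \<theta>]
      have rt: "0 < r * t" using r t by simp
      have "\<bar>u\<bar> \<le> r * t / 2 + 1 / (2 * (r * t)) * u\<^sup>2" for u
      proof -
        have "0 \<le> (\<bar>u\<bar> - r * t)\<^sup>2" by simp
        then have "\<bar>u\<bar> * (2 * (r * t)) \<le> (r * t)\<^sup>2 + u\<^sup>2"
          by (simp add: power2_diff mult_ac)
        then have "\<bar>u\<bar> \<le> ((r * t)\<^sup>2 + u\<^sup>2) / (2 * (r * t))"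
          using rt by (subst pos_le_divide_eq) auto
        also have "\<dots> = r * t / 2 + 1 / (2 * (r * t)) * u\<^sup>2"
          using rt by (simp add: add_divide_distrib power2_eq_square)
        finally show ?thesis .
      qed
      then have "(\<integral>w. \<bar>U 1 w\<bar> \<partial>P \<theta>) \<le> (\<integral>w. r * t / 2 + 1 / (2 * (r * t)) * (U 1 w)\<^sup>2 \<partial>P \<theta>)"
        using I by (intro integral_mono) auto
      also have "\<dots> = r * t / 2 + 1 / (2 * (r * t)) * (\<integral>w. (U 1 w)\<^sup>2 \<partial>P \<theta>)"
        using I prob_space by simp
      also have "\<dots> \<le> r * t / 2 + 1 / (2 * (r * t)) * (r * t)\<^sup>2"
        unfolding U2[symmetric] using rt
        by (intro add_left_mono mult_left_mono upper_exp_upper[OF adm_U2 \<theta>]) auto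
      also have "\<dots> = r * t" using rt by (simp add: power2_eq_square)
      finally show "(\<integral>w. \<bar>U 1 w\<bar> \<partial>P \<theta>) \<le> r * t" .
    qed
    \<comment> \<open>A linearised Lyapunov inequality: the normalised upper second moment is
      \<open>r\<^sup>2 \<ge> 1\<close>, and this forces the third moment above 1.\<close>
    have "1 \<le> \<beta>"
    proof -
      have "upper_exp (\<lambda>w. (X 1 w - \<mu>)\<^sup>2) \<le> (2 * \<beta> + 1) / 3 * \<sigma>\<^sup>2"
      proof (rule upper_exp_least)
        fix \<theta> assume \<theta>: "\<theta> \<in> \<Theta>"
        interpret prob_space "P \<theta>" using prob[OF \<theta>] .
        note I = admissible_integrable[OF square \<theta>] admissible_integrable[OF adm3 \<theta>]
        \<comment> \<open>the tangent of the convex map \<open>s \<mapsto> s powr (3/2)\<close> at \<open>s = 1\<close>\<close>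
        have "3 * y\<^sup>2 \<le> 2 * \<bar>y\<bar> ^ 3 + 1" for y :: real
        proof -
          have "0 \<le> (\<bar>y\<bar> - 1)\<^sup>2 * (2 * \<bar>y\<bar> + 1)" by simp
          also have "\<dots> = 2 * \<bar>y\<bar> ^ 3 + 1 - 3 * \<bar>y\<bar>\<^sup>2"
            by (simp add: power2_eq_square power3_eq_cube algebra_simps)
          finally show ?thesis by simp
        qed
        then have "3 * ((x - \<mu>) / \<sigma>)\<^sup>2 \<le> 2 * \<bar>(x - \<mu>) / \<sigma>\<bar> ^ 3 + 1" for x .
        then have "3 / \<sigma>\<^sup>2 * (x - \<mu>)\<^sup>2 \<le> 2 * \<bar>(x - \<mu>) / \<sigma>\<bar> ^ 3 + 1" for x
          by (simp add: power_divide)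
        then have "(\<integral>w. 3 / \<sigma>\<^sup>2 * (X 1 w - \<mu>)\<^sup>2 \<partial>P \<theta>) \<le> (\<integral>w. 2 * \<bar>(X 1 w - \<mu>) / \<sigma>\<bar> ^ 3 + 1 \<partial>P \<theta>)"
          using I by (intro integral_mono) auto
        also have "\<dots> = 2 * (\<integral>w. \<bar>(X 1 w - \<mu>) / \<sigma>\<bar> ^ 3 \<partial>P \<theta>) + 1"
          using I prob_space by simp
        also have "\<dots> \<le> 2 * \<beta> + 1"
          using upper_exp_upper[OF adm3 \<theta>] unfolding \<beta> by simp
        finally show "(\<integral>w. (X 1 w - \<mu>)\<^sup>2 \<partial>P \<theta>) \<le> (2 * \<beta> + 1) / 3 * \<sigma>\<^sup>2"
          using \<sigma> by (simp add: field_simps)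
      qed
      then have "r\<^sup>2 * \<sigma>\<^sup>2 \<le> (2 * \<beta> + 1) / 3 * \<sigma>\<^sup>2"
        by (simp only: var_r power_mult_distrib)
      then have "r\<^sup>2 \<le> (2 * \<beta> + 1) / 3"
        using \<sigma> by (simp only: mult_le_cancel_right) simp
      moreover have "1 \<le> r\<^sup>2" using r by simp
      ultimately show ?thesis by simp
    qed
    moreover have "(\<integral>w. U 1 w \<partial>P \<theta>) = 0" if \<theta>: "\<theta> \<in> \<Theta>" for \<theta>
    proof -
      interpret prob_space "P \<theta>" using prob[OF \<theta>] .
      have "integrable (P \<theta>) (X 1)"
        by (rule integrable_if_square_integrable[OF measurable_P[OF X1 \<theta>] admissible_integrable[OF square \<theta>]])
      then show ?thesis
        using mean[OF \<theta>] prob_space by (simp add: U_def)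
    qed
    moreover have "upper_exp (\<lambda>w. b * (U 1 w)\<^sup>2) = b * t\<^sup>2" if "0 \<le> sg * b" for b
    proof -
      have "0 \<le> sg * (b * c\<^sup>2)" using that by (simp flip: mult.assoc)
      from var[OF this] show ?thesis
        by (simp add: sq power_mult_distrib mult.assoc flip: ct)
    qed
    ultimately have "\<bar>upper_exp (\<lambda>w. \<phi> (S n w)) - heat \<phi> 1 0\<bar>
        \<le> (ln (real n) + 1) / sqrt (real n) * (2 * r + \<beta>) * L"
      using lip \<phi>(2) abs1 r sg cube by (intro lindeberg_bound[where t = t and sg = sg]) (auto simp: t_def)
    then show ?thesis
      unfolding lhs real L_def[symmetric] by simp
  next
    case PInf
    show ?thesis
    \<comment> \<open>An infinite third moment makes the right side infinite, except that infinity
      times 0 is 0. In that case \<open>\<phi>\<close> is constant and the left side vanishes as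
      well.\<close>
    proof (cases "L = 0")
      case True
      then have "\<phi> x = \<phi> 0" for x
        using lipschitz_realD[OF lip, of x 0] by simp
      then obtain k where "\<And>x. \<phi> x = k" by blast
      then have "upper_exp (\<lambda>w. \<phi> (S n w)) = heat \<phi> 1 0"
        using prob_space.prob_space[OF prob_std_gaussian] by (simp add: heat_def upper_exp_const)
      then show ?thesis
        unfolding lhs L_def[symmetric] True by (simp flip: zero_ereal_def)
    next
      case False
      then show ?thesis
        using L n factor unfolding lhs PInf L_def[symmetric] by simp
    qed
  next
    case MInf
    then show ?thesis using B_nonneg by simp
  qed
qed

end

theorem corollary3p1:
  fixes M :: "'a measure" and P :: "'t \<Rightarrow> 'a measure" and \<Theta> :: "'t set"
    and N :: "'b measure" and Z :: "'b \<Rightarrow> real"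
    and X :: "nat \<Rightarrow> 'a \<Rightarrow> real" and n :: nat
    and \<mu> \<sigma>_up \<sigma>_low :: real
  assumes "\<Theta> \<noteq> {}"
    and "\<And>\<theta>. \<theta> \<in> \<Theta> \<Longrightarrow> prob_space (P \<theta>)"
    and "\<And>\<theta>. \<theta> \<in> \<Theta> \<Longrightarrow> sets (P \<theta>) = sets M"
    and "n \<ge> 1"
    and "\<And>i. i \<in> {1..n} \<Longrightarrow> X i \<in> borel_measurable M"
    and "iid (sublinear_expectation P \<Theta>) n X"
    and "\<And>\<theta>. \<theta> \<in> \<Theta> \<Longrightarrow> expectation_exists (P \<theta>) (X 1)"
    and "sublinear_expectation P \<Theta> (X 1) = ereal \<mu>"
    and "- sublinear_expectation P \<Theta> (\<lambda>w. - X 1 w) = ereal \<mu>"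
    and "\<sigma>_up \<ge> 0" and "ereal (\<sigma>_up\<^sup>2) = sublinear_expectation P \<Theta> (\<lambda>w. (X 1 w - \<mu>)\<^sup>2)"
    and "\<sigma>_low \<ge> 0" and "ereal (\<sigma>_low\<^sup>2) = - sublinear_expectation P \<Theta> (\<lambda>w. - (X 1 w - \<mu>)\<^sup>2)"
    and "prob_space N" and "distributed N lborel Z std_normal_density"
  shows
    "(\<sigma>_up > 0 \<longrightarrow>
       (\<forall>\<phi>\<in>lip. convex_on UNIV \<phi> \<longrightarrow>
          \<bar>sublinear_expectation P \<Theta>
              (\<lambda>w. \<phi> ((\<Sum>i=1..n. (X i w - \<mu>)) / (\<sigma>_up * sqrt (real n))))
            - ereal (\<integral>v. \<phi> (Z v) \<partial>N)\<bar>
          \<le> ereal ((ln (real n) + 1) / sqrt (real n))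
             * (2 + sublinear_expectation P \<Theta> (\<lambda>w. \<bar>(X 1 w - \<mu>) / \<sigma>_up\<bar> ^ 3))
             * ereal (lip_const \<phi>)))
     \<and>
     (\<sigma>_low > 0 \<longrightarrow>
       (\<forall>\<phi>\<in>lip. concave_on UNIV \<phi> \<longrightarrow>
          \<bar>sublinear_expectation P \<Theta>
              (\<lambda>w. \<phi> ((\<Sum>i=1..n. (X i w - \<mu>)) / (\<sigma>_low * sqrt (real n))))
            - ereal (\<integral>v. \<phi> (Z v) \<partial>N)\<bar>
          \<le> ereal ((ln (real n) + 1) / sqrt (real n))
             * (ereal (2 * \<sigma>_up / \<sigma>_low)
                + sublinear_expectation P \<Theta> (\<lambda>w. \<bar>(X 1 w - \<mu>) / \<sigma>_low\<bar> ^ 3))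
             * ereal (lip_const \<phi>)))"
proof -
  interpret prob_family M P \<Theta>
    by (intro prob_family.intro) (fact assms)+
  have X1 [measurable]: "X 1 \<in> borel_measurable M"
    using assms(4) by (intro assms(5)) simp
  have square: "admissible (\<lambda>w. (X 1 w - \<mu>)\<^sup>2)"
    by (rule admissible_nonneg[OF _ _ assms(11)[symmetric]]) auto
  have up: "upper_exp (\<lambda>w. (X 1 w - \<mu>)\<^sup>2) = \<sigma>_up\<^sup>2"
    using assms(11) sublinear_expectation_eq[OF square] by simp
  have neg_square: "admissible (\<lambda>w. - (X 1 w - \<mu>)\<^sup>2)"
    using admissible_cmult[OF square, of "- 1"] by simp
  have low: "upper_exp (\<lambda>w. - (X 1 w - \<mu>)\<^sup>2) = - \<sigma>_low\<^sup>2"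
    using assms(13) sublinear_expectation_eq[OF neg_square] by simp
  \<comment> \<open>Each single mean lies between \<open>- E[- X 1]\<close> and
    \<open>E[X 1]\<close>, which coincide, so the mean is certain under the whole family.\<close>
  have mean: "(\<integral>w. X 1 w \<partial>P \<theta>) = \<mu>" if \<theta>: "\<theta> \<in> \<Theta>" for \<theta>
  proof -
    have I: "integrable (P \<theta>) (X 1)"
      by (rule prob_space.integrable_if_square_integrable[OF prob[OF \<theta>] measurable_P[OF X1 \<theta>]
            admissible_integrable[OF square \<theta>]])
    have "ext_expectation (P \<theta>) (X 1) \<le> ereal \<mu>"
      unfolding assms(8)[symmetric] sublinear_expectation_def by (rule SUP_upper[OF \<theta>])
    moreover have "sublinear_expectation P \<Theta> (\<lambda>w. - X 1 w) = - ereal \<mu>"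
      using assms(9) by (metis ereal_uminus_uminus)
    then have "ext_expectation (P \<theta>) (\<lambda>w. - X 1 w) \<le> - ereal \<mu>"
      unfolding sublinear_expectation_def by (metis (no_types, lifting) SUP_upper[OF \<theta>])
    ultimately show ?thesis
      using I by (simp add: ext_expectation_integrable)
  qed
  note bound = clt_bound[where \<mu> = \<mu> and X = X and n = n, OF assms(4-6) square mean _ _ _ _ _ _ _ assms(14,15)]
  show ?thesis
  proof (intro conjI impI ballI)
    fix \<phi> assume \<sigma>: "0 < \<sigma>_up" and \<phi>: "\<phi> \<in> lip" "convex_on UNIV \<phi>"
    have "upper_exp (\<lambda>w. b * (X 1 w - \<mu>)\<^sup>2) = b * \<sigma>_up\<^sup>2" if "0 \<le> 1 * b" for b
      using upper_exp_cmult[OF square, of b] that up by simp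
    then show "\<bar>sublinear_expectation P \<Theta>
              (\<lambda>w. \<phi> ((\<Sum>i=1..n. (X i w - \<mu>)) / (\<sigma>_up * sqrt (real n))))
            - ereal (\<integral>v. \<phi> (Z v) \<partial>N)\<bar>
          \<le> ereal ((ln (real n) + 1) / sqrt (real n))
             * (2 + sublinear_expectation P \<Theta> (\<lambda>w. \<bar>(X 1 w - \<mu>) / \<sigma>_up\<bar> ^ 3))
             * ereal (lip_const \<phi>)"
      using bound[of \<sigma>_up 1 1 \<phi>] \<sigma> \<phi> up by simp
  next
    fix \<phi> assume \<sigma>: "0 < \<sigma>_low" and \<phi>: "\<phi> \<in> lip" "concave_on UNIV \<phi>"
    \<comment> \<open>For \<open>b \<le> 0\<close> the term is the nonnegative multiple
      \<open>- b\<close> of the negated square, whose upper expectation is minus the lower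
      variance.\<close>
    have "upper_exp (\<lambda>w. b * (X 1 w - \<mu>)\<^sup>2) = b * \<sigma>_low\<^sup>2" if "0 \<le> - 1 * b" for b
      using upper_exp_cmult[OF neg_square, of "- b"] that low by simp
    \<comment> \<open>Under any single measure the second moment about \<open>\<mu>\<close> lies
      between the lower and the upper variance.\<close>
    moreover have "1 \<le> \<sigma>_up / \<sigma>_low"
    proof -
      obtain \<theta> where \<theta>: "\<theta> \<in> \<Theta>" using assms(1) by blast
      have "\<sigma>_low\<^sup>2 \<le> \<sigma>_up\<^sup>2"
        using upper_exp_upper[OF square \<theta>] upper_exp_upper[OF neg_square \<theta>] up low by simp
      then have "\<sigma>_low \<le> \<sigma>_up" using assms(10) by (rule power2_le_imp_le)
      then show ?thesis using \<sigma> by simp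
    qed
    moreover have "convex_on UNIV (\<lambda>x. - 1 * \<phi> x)"
      using \<phi>(2) by (simp add: concave_on_def)
    moreover have "upper_exp (\<lambda>w. (X 1 w - \<mu>)\<^sup>2) = (\<sigma>_up / \<sigma>_low * \<sigma>_low)\<^sup>2"
      using up \<sigma> by simp
    ultimately show "\<bar>sublinear_expectation P \<Theta>
              (\<lambda>w. \<phi> ((\<Sum>i=1..n. (X i w - \<mu>)) / (\<sigma>_low * sqrt (real n))))
            - ereal (\<integral>v. \<phi> (Z v) \<partial>N)\<bar>
          \<le> ereal ((ln (real n) + 1) / sqrt (real n))
             * (ereal (2 * \<sigma>_up / \<sigma>_low)
                + sublinear_expectation P \<Theta> (\<lambda>w. \<bar>(X 1 w - \<mu>) / \<sigma>_low\<bar> ^ 3))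
             * ereal (lip_const \<phi>)"
      using bound[of \<sigma>_low "\<sigma>_up / \<sigma>_low" "- 1" \<phi>] \<sigma> \<phi>(1) by simp
  qed
qed

end
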